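(* Let $(\mathcal R,\mathcal D,\mathcal V,\mathcal E)$ be a subregular risk quadrangle with statistic $\mathcal S$, on $\mathcal L^p$. Then the following hold. (a) The relations $\mathcal D(X)=\mathcal R(X)-\mathbb E[X]$ and $\mathcal R(X)=\mathbb E[X]+\mathcal D(X)$ give a one-to-one correspondence between subregular measures of risk $\mathcal R$ and subregular measures of deviation $\mathcal D$. In this correspondence, $\mathcal R$ is positively homogeneous if and only if $\mathcal D$ is positively homogeneous. Moreover, $\mathcal R$ is monotone if and only if $\mathcal D(X)\le \operatorname{ess\,sup}X-\mathbb E[X]$ for all $X$. (b) The relations $\mathcal E(X)=\mathcal V(X)-\mathbb E[X]$ and $\mathcal V(X)=\mathbb E[X]+\mathcal E(X)$ give a one-to-one correspondence between subregular measures of regret $\mathcal V$ and subregular measures of error $\mathcal E$. In this correspondence, $\mathcal V$ is positively homogeneous if and only if $\mathcal E$ is positively homogeneous. Moreover, $\mathcal V$ is monotone if and only if $\mathcal E(X)\le|\mathbb E[X]|$ for all $X\le 0$. (c) For any subregular measure of regret $\mathcal V$, a subregular measure of risk $\mathcal R$ is obtained by $$\mathcal R(X)=\inf_{C\in\mathbb R}\{C+\mathcal V(X-C)\}.$$ If $\mathcal V$ is positively homogeneous, then $\mathcal R$ is positively homogeneous. If $\mathcal V$ is monotone, then $\mathcal R$ is monotone. (d) For any subregular measure of error $\mathcal E$, a subregular measure of deviation $\mathcal D$ is obtained by $$\mathcal D(X)=\inf_{C\in\mathbb R}\{\mathcal E(X-C)\}.$$ If $\mathcal E$ is positively homogeneous,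 then $\mathcal D$ is positively homogeneous. If $\mathcal E(X)\le|\mathbb E[X]|$ for all $X\le0$, then $\mathcal D(X)\le\operatorname{ess\,sup}X-\mathbb E[X]$ for all $X$. (e) In both (c) and (d), for each $X$, as long as the expression being minimized is finite for some $C$, the set of $C$ values for which the minimum is attained is a nonempty closed bounded interval. Moreover, when $\mathcal V$ and $\mathcal E$ are paired as in (b), the interval comes out the same and gives the associated statistic $$\mathcal S(X)=\operatorname*{argmin}_{C}\{C+\mathcal V(X-C)\}=\operatorname*{argmin}_{C}\{\mathcal E(X-C)\},$$ with $\mathcal S(X+C)=\mathcal S(X)+C$ for every constant $C$.
   Context: Let $(\Omega,\mathcal M,\mathbb P)$ be a probability space. For $p\in[1,\infty]$, $\mathcal L^p=\mathcal L^p(\Omega,\mathcal M,\mathbb P)$ is the normed space of random variables (identified when equal almost surely) with $\|X\|_p<\infty$. Constants $C\in\mathbb R$ are identified with constant random variables, and (in)equalities between random variables are almost sure. A functional $\mathcal F:\mathcal L^p\to(-\infty,\infty]$ is closed if $\{X:\mathcal F(X)\le C\}$ is closed in $\mathcal L^p$ for every constant $C$. It is monotone if $\mathcal F(X)\le\mathcal F(Y)$ whenever $X\le Y$ almost surely, and positively homogeneous if $\mathcal F(\lambda X)=\lambda\mathcal F(X)$ for all $\lambda>0$. A subregular measure of risk is a closed convex $\mathcal R:\mathcal L^p\to(-\infty,\infty]$ such that $\mathcal R(C)=C$ for constants $C$, $\mathcal R(X)\ge\mathbb E[X]$ for all $X$, and for every non-constant $X$ there is $\lambda>0$ with $\mathcal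 R(\lambda X)>\mathbb E[\lambda X]$. A subregular measure of deviation is a closed convex $\mathcal D:\mathcal L^p\to[0,\infty]$ such that $\mathcal D(C)=0$ for constants $C$, and for every non-constant $X$ there is $\lambda>0$ with $\mathcal D(\lambda X)>0$. A subregular measure of regret is a closed convex $\mathcal V:\mathcal L^p\to(-\infty,\infty]$ such that $\mathcal V(0)=0$, $\mathcal V(X)\ge\mathbb E[X]$ for all $X$, and for every non-zero $X$ there is $\lambda>0$ with $\mathcal V(\lambda X)>\mathbb E[\lambda X]$. A subregular measure of error is a closed convex $\mathcal E:\mathcal L^p\to[0,\infty]$ such that $\mathcal E(0)=0$, and for every non-zero $X$ there is $\lambda>0$ with $\mathcal E(\lambda X)>0$. A subregular risk quadrangle with statistic $\mathcal S$ is a quartet $(\mathcal R,\mathcal D,\mathcal V,\mathcal E)$ of subregular measures of risk, deviation, regret and error satisfying, for all $X$: (Q1) $\mathcal D(X)=\min_C\mathcal E(X-C)$; (Q2) $\mathcal R(X)=\min_C\{C+\mathcal V(X-C)\}$; (Q3) $\mathcal R(X)=\mathcal D(X)+\mathbb E[X]$ and $\mathcal V(X)=\mathcal E(X)+\mathbb E[X]$; (Q4) $\mathcal S(X)=\operatorname{argmin}_C\mathcal E(X-C)=\operatorname{argmin}_C\{C+\mathcal V(X-C)\}$, a set of real numbers. *)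

theory Defs
  imports "HOL-Probability.Probability"
begin

text \<open>
  Elements of $L^p$ are represented by their measurable representatives, so that
  \<open>Lp_norm\<close> is only a seminorm on \<open>Lp_space\<close>; the identification of almost surely equal random
  variables is made by requiring every functional to be invariant under it (\<open>Lp_functionals\<close>).
\<close>

definition Lp_space :: "'a measure \<Rightarrow> ennreal \<Rightarrow> ('a \<Rightarrow> real) set" where
  "Lp_space M p = {X \<in> borel_measurable M.
     if p = \<infinity> then esssup M (\<lambda>\<omega>. ereal \<bar>X \<omega>\<bar>) < \<infinity>
     else integrable M (\<lambda>\<omega>. \<bar>X \<omega>\<bar> powr enn2real p)}"

definition Lp_norm :: "'a measure \<Rightarrow> ennreal \<Rightarrow> ('a \<Rightarrow> real) \<Rightarrow> real" where
  "Lp_norm M p X =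
     (if p = \<infinity> then real_of_ereal (esssup M (\<lambda>\<omega>. ereal \<bar>X \<omega>\<bar>))
      else (LINT \<omega>|M. \<bar>X \<omega>\<bar> powr enn2real p) powr (1 / enn2real p))"

definition Lp_closed :: "'a measure \<Rightarrow> ennreal \<Rightarrow> ('a \<Rightarrow> real) set \<Rightarrow> bool" where
  "Lp_closed M p A \<longleftrightarrow> A \<subseteq> Lp_space M p \<and>
     (\<forall>X \<in> Lp_space M p - A. \<exists>\<epsilon>>0. \<forall>Y \<in> Lp_space M p.
        Lp_norm M p (\<lambda>\<omega>. Y \<omega> - X \<omega>) < \<epsilon> \<longrightarrow> Y \<notin> A)"

text \<open>
  Functionals are extensional (\<open>undefined\<close> outside \<open>Lp_space\<close>), so that
  equality in HOL is equality of functionals on $L^p$.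
\<close>

definition Lp_functionals ::
    "'a measure \<Rightarrow> ennreal \<Rightarrow> ereal set \<Rightarrow> (('a \<Rightarrow> real) \<Rightarrow> ereal) set" where
  "Lp_functionals M p T = {F \<in> Lp_space M p \<rightarrow>\<^sub>E T.
     \<forall>X \<in> Lp_space M p. \<forall>Y \<in> Lp_space M p. (AE \<omega> in M. X \<omega> = Y \<omega>) \<longrightarrow> F X = F Y}"

definition closed_functional ::
    "'a measure \<Rightarrow> ennreal \<Rightarrow> (('a \<Rightarrow> real) \<Rightarrow> ereal) \<Rightarrow> bool" where
  "closed_functional M p F \<longleftrightarrow> (\<forall>C::real. Lp_closed M p {X \<in> Lp_space M p. F X \<le> ereal C})"

definition convex_functional ::
    "'a measure \<Rightarrow> ennreal \<Rightarrow> (('a \<Rightarrow> real) \<Rightarrow> ereal) \<Rightarrow> bool" where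
  "convex_functional M p F \<longleftrightarrow>
     (\<forall>X \<in> Lp_space M p. \<forall>Y \<in> Lp_space M p. \<forall>t::real. 0 < t \<and> t < 1 \<longrightarrow>
        F (\<lambda>\<omega>. (1 - t) * X \<omega> + t * Y \<omega>) \<le> ereal (1 - t) * F X + ereal t * F Y)"

definition monotone_functional ::
    "'a measure \<Rightarrow> ennreal \<Rightarrow> (('a \<Rightarrow> real) \<Rightarrow> ereal) \<Rightarrow> bool" where
  "monotone_functional M p F \<longleftrightarrow>
     (\<forall>X \<in> Lp_space M p. \<forall>Y \<in> Lp_space M p. (AE \<omega> in M. X \<omega> \<le> Y \<omega>) \<longrightarrow> F X \<le> F Y)"

definition pos_homogeneous ::
    "'a measure \<Rightarrow> ennreal \<Rightarrow> (('a \<Rightarrow> real) \<Rightarrow> ereal) \<Rightarrow> bool" where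
  "pos_homogeneous M p F \<longleftrightarrow>
     (\<forall>X \<in> Lp_space M p. \<forall>l::real. l > 0 \<longrightarrow> F (\<lambda>\<omega>. l * X \<omega>) = ereal l * F X)"

definition as_constant :: "'a measure \<Rightarrow> ('a \<Rightarrow> real) \<Rightarrow> bool" where
  "as_constant M X \<longleftrightarrow> (\<exists>C. AE \<omega> in M. X \<omega> = C)"

definition as_zero :: "'a measure \<Rightarrow> ('a \<Rightarrow> real) \<Rightarrow> bool" where
  "as_zero M X \<longleftrightarrow> (AE \<omega> in M. X \<omega> = 0)"

definition risk_measures :: "'a measure \<Rightarrow> ennreal \<Rightarrow> (('a \<Rightarrow> real) \<Rightarrow> ereal) set" where
  "risk_measures M p = {R \<in> Lp_functionals M p {-\<infinity><..}.
     closed_functional M p R \<and> convex_functional M p R \<and>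
     (\<forall>C. R (\<lambda>_. C) = ereal C) \<and>
     (\<forall>X \<in> Lp_space M p. R X \<ge> ereal (LINT \<omega>|M. X \<omega>)) \<and>
     (\<forall>X \<in> Lp_space M p. \<not> as_constant M X \<longrightarrow>
        (\<exists>l::real. l > 0 \<and> R (\<lambda>\<omega>. l * X \<omega>) > ereal (LINT \<omega>|M. l * X \<omega>)))}"

definition deviation_measures :: "'a measure \<Rightarrow> ennreal \<Rightarrow> (('a \<Rightarrow> real) \<Rightarrow> ereal) set" where
  "deviation_measures M p = {D \<in> Lp_functionals M p {0..}.
     closed_functional M p D \<and> convex_functional M p D \<and>
     (\<forall>C. D (\<lambda>_. C) = 0) \<and>
     (\<forall>X \<in> Lp_space M p. \<not> as_constant M X \<longrightarrow>
        (\<exists>l::real. l > 0 \<and> D (\<lambda>\<omega>. l * X \<omega>) > 0))}"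

definition regret_measures :: "'a measure \<Rightarrow> ennreal \<Rightarrow> (('a \<Rightarrow> real) \<Rightarrow> ereal) set" where
  "regret_measures M p = {V \<in> Lp_functionals M p {-\<infinity><..}.
     closed_functional M p V \<and> convex_functional M p V \<and>
     V (\<lambda>_. 0) = 0 \<and>
     (\<forall>X \<in> Lp_space M p. V X \<ge> ereal (LINT \<omega>|M. X \<omega>)) \<and>
     (\<forall>X \<in> Lp_space M p. \<not> as_zero M X \<longrightarrow>
        (\<exists>l::real. l > 0 \<and> V (\<lambda>\<omega>. l * X \<omega>) > ereal (LINT \<omega>|M. l * X \<omega>)))}"

definition error_measures :: "'a measure \<Rightarrow> ennreal \<Rightarrow> (('a \<Rightarrow> real) \<Rightarrow> ereal) set" where
  "error_measures M p = {E \<in> Lp_functionals M p {0..}.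
     closed_functional M p E \<and> convex_functional M p E \<and>
     E (\<lambda>_. 0) = 0 \<and>
     (\<forall>X \<in> Lp_space M p. \<not> as_zero M X \<longrightarrow>
        (\<exists>l::real. l > 0 \<and> E (\<lambda>\<omega>. l * X \<omega>) > 0))}"

definition is_min_value :: "ereal \<Rightarrow> (real \<Rightarrow> ereal) \<Rightarrow> bool" where
  "is_min_value m f \<longleftrightarrow> m \<in> range f \<and> (\<forall>C. m \<le> f C)"

text \<open>The set of minimisers; it is all of \<open>UNIV\<close> if \<open>f\<close> is constantly \<open>\<infinity>\<close>.\<close>

definition argmin_set :: "(real \<Rightarrow> ereal) \<Rightarrow> real set" where
  "argmin_set f = {C. is_arg_min f (\<lambda>_. True) C}"

definition regret_objective :: "(('a \<Rightarrow> real) \<Rightarrow> ereal) \<Rightarrow> ('a \<Rightarrow> real) \<Rightarrow> real \<Rightarrow> ereal" where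
  "regret_objective V X C = ereal C + V (\<lambda>\<omega>. X \<omega> - C)"

definition error_objective :: "(('a \<Rightarrow> real) \<Rightarrow> ereal) \<Rightarrow> ('a \<Rightarrow> real) \<Rightarrow> real \<Rightarrow> ereal" where
  "error_objective E X C = E (\<lambda>\<omega>. X \<omega> - C)"

definition risk_quadrangle ::
    "'a measure \<Rightarrow> ennreal \<Rightarrow> (('a \<Rightarrow> real) \<Rightarrow> ereal) \<Rightarrow> (('a \<Rightarrow> real) \<Rightarrow> ereal) \<Rightarrow>
     (('a \<Rightarrow> real) \<Rightarrow> ereal) \<Rightarrow> (('a \<Rightarrow> real) \<Rightarrow> ereal) \<Rightarrow> (('a \<Rightarrow> real) \<Rightarrow> real set) \<Rightarrow> bool" where
  "risk_quadrangle M p R D V E S \<longleftrightarrow>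
     R \<in> risk_measures M p \<and> D \<in> deviation_measures M p \<and>
     V \<in> regret_measures M p \<and> E \<in> error_measures M p \<and>
     (\<forall>X \<in> Lp_space M p.
        is_min_value (D X) (error_objective E X) \<and>
        is_min_value (R X) (regret_objective V X) \<and>
        R X = D X + ereal (LINT \<omega>|M. X \<omega>) \<and>
        V X = E X + ereal (LINT \<omega>|M. X \<omega>) \<and>
        S X = argmin_set (error_objective E X) \<and>
        S X = argmin_set (regret_objective V X))"

definition minus_expectation ::
    "'a measure \<Rightarrow> ennreal \<Rightarrow> (('a \<Rightarrow> real) \<Rightarrow> ereal) \<Rightarrow> (('a \<Rightarrow> real) \<Rightarrow> ereal)" where
  "minus_expectation M p F = (\<lambda>X \<in> Lp_space M p. F X - ereal (LINT \<omega>|M. X \<omega>))"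

definition plus_expectation ::
    "'a measure \<Rightarrow> ennreal \<Rightarrow> (('a \<Rightarrow> real) \<Rightarrow> ereal) \<Rightarrow> (('a \<Rightarrow> real) \<Rightarrow> ereal)" where
  "plus_expectation M p F = (\<lambda>X \<in> Lp_space M p. ereal (LINT \<omega>|M. X \<omega>) + F X)"

definition risk_of_regret ::
    "'a measure \<Rightarrow> ennreal \<Rightarrow> (('a \<Rightarrow> real) \<Rightarrow> ereal) \<Rightarrow> (('a \<Rightarrow> real) \<Rightarrow> ereal)" where
  "risk_of_regret M p V = (\<lambda>X \<in> Lp_space M p. INF C. regret_objective V X C)"

definition deviation_of_error ::
    "'a measure \<Rightarrow> ennreal \<Rightarrow> (('a \<Rightarrow> real) \<Rightarrow> ereal) \<Rightarrow> (('a \<Rightarrow> real) \<Rightarrow> ereal)" where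
  "deviation_of_error M p E = (\<lambda>X \<in> Lp_space M p. INF C. error_objective E X C)"

definition deviation_bounded ::
    "'a measure \<Rightarrow> ennreal \<Rightarrow> (('a \<Rightarrow> real) \<Rightarrow> ereal) \<Rightarrow> bool" where
  "deviation_bounded M p D \<longleftrightarrow>
     (\<forall>X \<in> Lp_space M p. D X \<le> esssup M (\<lambda>\<omega>. ereal (X \<omega>)) - ereal (LINT \<omega>|M. X \<omega>))"

definition error_bounded ::
    "'a measure \<Rightarrow> ennreal \<Rightarrow> (('a \<Rightarrow> real) \<Rightarrow> ereal) \<Rightarrow> bool" where
  "error_bounded M p E \<longleftrightarrow>
     (\<forall>X \<in> Lp_space M p. (AE \<omega> in M. X \<omega> \<le> 0) \<longrightarrow> E X \<le> ereal \<bar>LINT \<omega>|M. X \<omega>\<bar>)"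

end

theory Submission
  imports Defs
begin

text \<open>
  Adding or subtracting the expectation, a continuous linear functional, preserves closedness,
  convexity and positive homogeneity, so everything about regret and risk reduces to error and
  deviation. The hard point is that the projected deviation inherits lower semicontinuity and
  attains its minimum: an error \<open>E\<close> is coercive along constants, locally uniformly in \<open>X\<close>, because
  if \<open>E (X\<^sub>n - C\<^sub>n)\<close> stayed bounded with \<open>\<bar>C\<^sub>n\<bar> \<rightarrow> \<infinity>\<close> and \<open>X\<^sub>n\<close> bounded, rescaling by
  \<open>l / \<bar>C\<^sub>n\<bar>\<close> would make \<open>E\<close> vanish at \<open>l\<close> for every \<open>l > 0\<close>, or at \<open>- l\<close> for every \<open>l > 0\<close>.
\<close>

text \<open>An infimum over all constants \<open>C\<close> of a closed convex functional need be
  neither attained nor closed, since the line of constants is not compact. Nondegeneracy of the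
  error at the constants 1 and -1, with convexity and \<open>E (\<lambda>_. 0) = 0\<close>, restores
  compactness: \<open>bounded_shifts_subsequence\<close> yields attainment, closedness and
  nondegeneracy of the deviation and compactness of the set of minimisers. The regret problem is the
  error problem in disguise: in \<open>C + V (X - C)\<close> the constant cancels against the
  expectation of \<open>X - C\<close>, leaving the error at \<open>X - C\<close> plus the
  expectation of \<open>X\<close>. Both monotonicity criteria amount to the functional being
  nonpositive on nonpositive variables; full monotonicity is recovered from this by convexity and
  closedness. The norm enters only through boundedness and convergence to zero. A triangle
  inequality with constant 4 therefore stands in for Minkowski, and a bound of the expectation by
  twice the norm for Jensen.\<close>

section \<open>Elementary inequalities for powers and extended reals\<close>

lemma abs_add_powr_le:
  fixes x y q :: real
  assumes "0 \<le> q"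
  shows "\<bar>x + y\<bar> powr q \<le> 2 powr q * (\<bar>x\<bar> powr q + \<bar>y\<bar> powr q)"
proof -
  have "\<bar>x + y\<bar> powr q \<le> (2 * max \<bar>x\<bar> \<bar>y\<bar>) powr q"
    using assms by (intro powr_mono2) auto
  also have "\<dots> = 2 powr q * max \<bar>x\<bar> \<bar>y\<bar> powr q"
    by (simp add: powr_mult)
  also have "\<dots> \<le> 2 powr q * (\<bar>x\<bar> powr q + \<bar>y\<bar> powr q)"
    by (intro mult_left_mono) (auto simp: max_def)
  finally show ?thesis .
qed

text \<open>The 4 is 2 times 2: one factor is the root of \<open>2 powr q\<close>, the other bounds
  \<open>2 powr (1 / q)\<close>, which comes from replacing \<open>a + b\<close> by
  \<open>2 * max a b\<close>. With \<open>abs_add_powr_le\<close> this gives the triangle inequality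
  with constant 4.\<close>

lemma root_add_powr_le:
  fixes a b q :: real
  assumes "0 \<le> a" "0 \<le> b" "1 \<le> q"
  shows "(2 powr q * (a + b)) powr (1 / q) \<le> 4 * (a powr (1 / q) + b powr (1 / q))"
proof -
  have "(2 powr q * (a + b)) powr (1 / q) \<le> (2 powr q * (2 * max a b)) powr (1 / q)"
    using assms by (intro powr_mono2 mult_left_mono) auto
  also have "\<dots> = 2 * (2 powr (1 / q) * max a b powr (1 / q))"
    using assms by (simp add: powr_mult powr_powr)
  also have "\<dots> \<le> 2 * (2 powr 1 * (a powr (1 / q) + b powr (1 / q)))"
    using assms by (intro mult_left_mono mult_mono powr_mono) (auto simp: max_def)
  finally show ?thesis by simp
qed

text \<open>The unevaluated factors \<open>- 1 *\<close> here and \<open>1 *\<close> below match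
  \<open>F X + ereal (a * expectation X)\<close> at \<open>a = - 1\<close> and \<open>a = 1\<close>,
  so that these equivalences rewrite the axioms of one kind of measure into those of its
  partner.\<close>

lemma ereal_minus_real_nonneg_iff: "0 \<le> x + ereal (- 1 * e) \<longleftrightarrow> ereal e \<le> x"
  by (cases x) auto

lemma ereal_minus_real_pos_iff: "0 < x + ereal (- 1 * e) \<longleftrightarrow> ereal e < x"
  by (cases x) auto

lemma ereal_le_plus_real_iff: "ereal e \<le> x + ereal (1 * e) \<longleftrightarrow> 0 \<le> x"
  by (cases x) auto

lemma ereal_less_plus_real_iff: "ereal e < x + ereal (1 * e) \<longleftrightarrow> 0 < x"
  by (cases x) auto

lemma ereal_add_real_le_iff: "a + ereal e \<le> b + ereal e \<longleftrightarrow> a \<le> b"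
  by (cases a; cases b) auto

section \<open>The space \<open>L\<close>, its norm, and continuity of the expectation\<close>

locale Lp_prob_space = prob_space M for M :: "'a measure" +
  fixes p :: ennreal
  assumes one_le_p: "1 \<le> p"
begin

abbreviation L where "L \<equiv> Lp_space M p"
abbreviation N where "N \<equiv> Lp_norm M p"

lemma one_le_enn2real_p:
  assumes "p \<noteq> \<infinity>"
  shows "1 \<le> enn2real p"
  using enn2real_mono[OF one_le_p] assms by (simp add: top.not_eq_extremum)

lemma Lp_measurable [measurable_dest]: "X \<in> L \<Longrightarrow> X \<in> borel_measurable M"
  by (simp add: Lp_space_def)

lemma Lp_infty:
  assumes p: "p = \<infinity>" and X: "X \<in> L"
  shows "AE \<omega> in M. \<bar>X \<omega>\<bar> \<le> N X" and "0 \<le> N X"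
proof -
  let ?s = "esssup M (\<lambda>\<omega>. ereal \<bar>X \<omega>\<bar>)"
  have [measurable]: "X \<in> borel_measurable M" using X by simp
  have fin: "?s < \<infinity>" using X p by (simp add: Lp_space_def)
  have ae: "AE \<omega> in M. ereal \<bar>X \<omega>\<bar> \<le> ?s"
    by (rule esssup_AE)
  \<comment> \<open>The claim does not depend on \<open>\<omega>\<close>, so on a probability space
    it holds outright. It excludes the value \<open>-\<infinity>\<close>, which
    \<open>real_of_ereal\<close> would silently send to 0.\<close>
  then have "AE \<omega> in M. 0 \<le> ?s"
    by eventually_elim (metis abs_ge_zero ereal_less_eq(5) order_trans)
  then have "0 \<le> ?s" by simp
  then have "?s = ereal (N X)" "0 \<le> N X"
    using fin p by (auto simp: Lp_norm_def ereal_real real_of_ereal_pos)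
  then show "AE \<omega> in M. \<bar>X \<omega>\<bar> \<le> N X" "0 \<le> N X" using ae by simp_all
qed

lemma Lp_infty_I:
  assumes p: "p = \<infinity>" and [measurable]: "X \<in> borel_measurable M"
    and le: "AE \<omega> in M. \<bar>X \<omega>\<bar> \<le> c"
  shows "X \<in> L" and "N X \<le> c"
proof -
  have "AE \<omega> in M. ereal \<bar>X \<omega>\<bar> \<le> ereal c" using le by simp
  then have s: "esssup M (\<lambda>\<omega>. ereal \<bar>X \<omega>\<bar>) \<le> ereal c" by (intro esssup_I) auto
  then have "esssup M (\<lambda>\<omega>. ereal \<bar>X \<omega>\<bar>) < \<infinity>" by (rule le_less_trans) simp
  then show X: "X \<in> L" using p by (simp add: Lp_space_def)
  have "AE \<omega> in M. 0 \<le> c" using le by eventually_elim auto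
  then have "0 \<le> c" by simp
  with s p show "N X \<le> c" by (simp add: Lp_norm_def real_le_ereal_iff)
qed

lemma Lp_norm_nonneg: "X \<in> L \<Longrightarrow> 0 \<le> N X"
  using Lp_infty(2)[of X] by (cases "p = \<infinity>") (auto simp: Lp_norm_def)

lemma Lp_const: "(\<lambda>_. C) \<in> L" and Lp_norm_const: "N (\<lambda>_. C) \<le> \<bar>C\<bar>"
proof -
  have "(\<lambda>_. C) \<in> L \<and> N (\<lambda>_. C) \<le> \<bar>C\<bar>"
  proof (cases "p = \<infinity>")
    case True
    then show ?thesis using Lp_infty_I[of "\<lambda>_. C" "\<bar>C\<bar>"] by simp
  next
    case False
    then show ?thesis
      using one_le_enn2real_p by (simp add: Lp_space_def Lp_norm_def powr_powr prob_space)
  qed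
  then show "(\<lambda>_. C) \<in> L" and "N (\<lambda>_. C) \<le> \<bar>C\<bar>" by auto
qed

lemma
  assumes X: "X \<in> L"
  shows Lp_scale: "(\<lambda>\<omega>. c * X \<omega>) \<in> L"
    and Lp_norm_scale: "N (\<lambda>\<omega>. c * X \<omega>) \<le> \<bar>c\<bar> * N X"
proof -
  have [measurable]: "X \<in> borel_measurable M" using X by simp
  have "(\<lambda>\<omega>. c * X \<omega>) \<in> L \<and> N (\<lambda>\<omega>. c * X \<omega>) \<le> \<bar>c\<bar> * N X"
  proof (cases "p = \<infinity>")
    case True
    have "AE \<omega> in M. \<bar>c * X \<omega>\<bar> \<le> \<bar>c\<bar> * N X"
      using Lp_infty(1)[OF True X] by eventually_elim (simp add: abs_mult mult_left_mono)
    then show ?thesis using Lp_infty_I[OF True, of "\<lambda>\<omega>. c * X \<omega>"] by simp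
  next
    case False
    then show ?thesis using X one_le_enn2real_p
      by (simp add: Lp_space_def Lp_norm_def abs_mult powr_mult powr_powr)
  qed
  then show "(\<lambda>\<omega>. c * X \<omega>) \<in> L" and "N (\<lambda>\<omega>. c * X \<omega>) \<le> \<bar>c\<bar> * N X" by auto
qed

text \<open>The constant 4 is harmless: the estimate serves only to carry over boundedness and
  convergence to zero.\<close>

lemma
  assumes X: "X \<in> L" and Y: "Y \<in> L"
  shows Lp_add: "(\<lambda>\<omega>. X \<omega> + Y \<omega>) \<in> L"
    and Lp_norm_add: "N (\<lambda>\<omega>. X \<omega> + Y \<omega>) \<le> 4 * (N X + N Y)"
proof -
  have [measurable]: "X \<in> borel_measurable M" "Y \<in> borel_measurable M" using X Y by simp_all
  have "(\<lambda>\<omega>. X \<omega> + Y \<omega>) \<in> L \<and> N (\<lambda>\<omega>. X \<omega> + Y \<omega>) \<le> 4 * (N X + N Y)"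
  proof (cases "p = \<infinity>")
    case True
    have "AE \<omega> in M. \<bar>X \<omega> + Y \<omega>\<bar> \<le> N X + N Y"
      using Lp_infty(1)[OF True X] Lp_infty(1)[OF True Y] by eventually_elim linarith
    then show ?thesis using Lp_infty_I[OF True, of "\<lambda>\<omega>. X \<omega> + Y \<omega>"]
        Lp_norm_nonneg[OF X] Lp_norm_nonneg[OF Y] by fastforce
  next
    case False
    let ?q = "enn2real p"
    note q = one_le_enn2real_p[OF False]
    let ?I = "\<lambda>X. LINT \<omega>|M. \<bar>X \<omega>\<bar> powr ?q"
    have iX: "integrable M (\<lambda>\<omega>. \<bar>X \<omega>\<bar> powr ?q)" and iY: "integrable M (\<lambda>\<omega>. \<bar>Y \<omega>\<bar> powr ?q)"
      using X Y False by (auto simp: Lp_space_def)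
    have iB: "integrable M (\<lambda>\<omega>. 2 powr ?q * (\<bar>X \<omega>\<bar> powr ?q + \<bar>Y \<omega>\<bar> powr ?q))"
      using iX iY by simp
    have iXY: "integrable M (\<lambda>\<omega>. \<bar>X \<omega> + Y \<omega>\<bar> powr ?q)"
      using abs_add_powr_le[of ?q] q by (intro Bochner_Integration.integrable_bound[OF iB]) auto
    have "?I (\<lambda>\<omega>. X \<omega> + Y \<omega>) \<le> 2 powr ?q * (?I X + ?I Y)"
      using integral_mono[OF iXY iB] abs_add_powr_le[of ?q] q iX iY by simp
    then have "?I (\<lambda>\<omega>. X \<omega> + Y \<omega>) powr (1 / ?q) \<le> (2 powr ?q * (?I X + ?I Y)) powr (1 / ?q)"
      using q by (intro powr_mono2) auto
    also have "\<dots> \<le> 4 * (?I X powr (1 / ?q) + ?I Y powr (1 / ?q))"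
      using q by (intro root_add_powr_le) auto
    finally show ?thesis using iXY False by (simp add: Lp_space_def Lp_norm_def)
  qed
  then show "(\<lambda>\<omega>. X \<omega> + Y \<omega>) \<in> L" and "N (\<lambda>\<omega>. X \<omega> + Y \<omega>) \<le> 4 * (N X + N Y)" by auto
qed

lemma Lp_shift: "X \<in> L \<Longrightarrow> (\<lambda>\<omega>. X \<omega> - C) \<in> L" "X \<in> L \<Longrightarrow> (\<lambda>\<omega>. X \<omega> + C) \<in> L"
  using Lp_add[OF _ Lp_const, of X "- C"] Lp_add[OF _ Lp_const, of X C] by simp_all

lemma Lp_diff: "X \<in> L \<Longrightarrow> Y \<in> L \<Longrightarrow> (\<lambda>\<omega>. X \<omega> - Y \<omega>) \<in> L"
  using Lp_add[OF _ Lp_scale, of X Y "- 1"] by simp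

text \<open>For finite \<open>p\<close> everything follows from
  \<open>\<bar>x\<bar> \<le> 1 + \<bar>x\<bar> powr q\<close>: the right side is integrable, and its
  integral is at most 2 on the unit ball. Homogeneity then turns the bound on the ball into
  continuity of the expectation.\<close>

lemma Lp_integrable_le_2:
  assumes X: "X \<in> L"
  shows "integrable M X" and "N X \<le> 1 \<Longrightarrow> \<bar>expectation X\<bar> \<le> 2"
proof -
  have [measurable]: "X \<in> borel_measurable M" using X by simp
  have "integrable M X \<and> (N X \<le> 1 \<longrightarrow> \<bar>expectation X\<bar> \<le> 2)"
  proof (cases "p = \<infinity>")
    case True
    have int: "integrable M X"
      using Lp_infty(1)[OF True X] by (intro integrable_const_bound[where B = "N X"]) auto
    have "\<bar>expectation X\<bar> \<le> expectation (\<lambda>\<omega>. \<bar>X \<omega>\<bar>)" by (rule integral_abs_bound)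
    also have "\<dots> \<le> expectation (\<lambda>_. N X)"
      using Lp_infty(1)[OF True X] int by (intro integral_mono_AE) auto
    finally show ?thesis using int by (simp add: prob_space)
  next
    case False
    let ?q = "enn2real p"
    note q = one_le_enn2real_p[OF False]
    let ?I = "LINT \<omega>|M. \<bar>X \<omega>\<bar> powr ?q"
    have i: "integrable M (\<lambda>\<omega>. 1 + \<bar>X \<omega>\<bar> powr ?q)"
      using X False by (auto simp: Lp_space_def)
    have le: "\<bar>x\<bar> \<le> 1 + \<bar>x\<bar> powr ?q" for x :: real
    proof (cases "1 \<le> \<bar>x\<bar>")
      case True
      then show ?thesis using powr_mono[OF q, of "\<bar>x\<bar>"] by simp
    qed (simp add: add_increasing2)
    have int: "integrable M X"
      using le by (intro Bochner_Integration.integrable_bound[OF i]) (auto simp: abs_of_nonneg)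
    have "\<bar>expectation X\<bar> \<le> expectation (\<lambda>\<omega>. \<bar>X \<omega>\<bar>)" by (rule integral_abs_bound)
    also have "\<dots> \<le> expectation (\<lambda>\<omega>. 1 + \<bar>X \<omega>\<bar> powr ?q)"
      using le int i by (intro integral_mono) auto
    also have "\<dots> = 1 + ?I" using X False by (simp add: Lp_space_def prob_space)
    finally have *: "\<bar>expectation X\<bar> \<le> 1 + ?I" .
    have "?I \<le> 1" if "N X \<le> 1"
    proof (rule ccontr)
      assume "\<not> ?I \<le> 1"
      then have "1 powr (1 / ?q) < ?I powr (1 / ?q)" using q by (intro powr_less_mono2) auto
      then show False using that False by (simp add: Lp_norm_def)
    qed
    then show ?thesis using * int by auto
  qed
  then show "integrable M X" and "N X \<le> 1 \<Longrightarrow> \<bar>expectation X\<bar> \<le> 2" by auto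
qed

lemmas Lp_integrable = Lp_integrable_le_2(1)

lemma abs_expectation_le:
  assumes X: "X \<in> L"
  shows "\<bar>expectation X\<bar> \<le> 2 * N X"
proof (rule field_le_epsilon)
  fix e :: real assume "0 < e"
  \<comment> \<open>The slack \<open>e / 2\<close> keeps the divisor positive when
    \<open>N X = 0\<close>, and doubling it gives exactly \<open>e\<close>.\<close>
  define r where "r = N X + e / 2"
  have r: "0 < r" "N X \<le> r" using \<open>0 < e\<close> Lp_norm_nonneg[OF X] by (auto simp: r_def)
  have "N (\<lambda>\<omega>. (1 / r) * X \<omega>) \<le> 1"
    using Lp_norm_scale[OF X, of "1 / r"] r by - (erule order_trans, simp)
  then have "\<bar>expectation (\<lambda>\<omega>. (1 / r) * X \<omega>)\<bar> \<le> 2"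
    by (rule Lp_integrable_le_2(2)[OF Lp_scale[OF X]])
  then have "\<bar>expectation X\<bar> \<le> 2 * r" using r by (simp add: field_simps)
  then show "\<bar>expectation X\<bar> \<le> 2 * N X + e" by (simp add: r_def)
qed


section \<open>Closedness as lower semicontinuity along sequences\<close>

lemma convex_functionalD:
  assumes "convex_functional M p F" "X \<in> L" "Y \<in> L" "0 < t" "t < 1"
  shows "F (\<lambda>\<omega>. (1 - t) * X \<omega> + t * Y \<omega>) \<le> ereal (1 - t) * F X + ereal t * F Y"
  using assms unfolding convex_functional_def by blast

lemma closed_functional_open:
  assumes F: "closed_functional M p F" and X: "X \<in> L" and b: "ereal b < F X"
  shows "\<exists>\<epsilon>>0. \<forall>Y\<in>L. N (\<lambda>\<omega>. Y \<omega> - X \<omega>) < \<epsilon> \<longrightarrow> ereal b < F Y"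
proof -
  have "X \<in> L - {X \<in> L. F X \<le> ereal b}" using X b by simp
  moreover have "Lp_closed M p {X \<in> L. F X \<le> ereal b}"
    using F by (simp add: closed_functional_def)
  ultimately obtain \<epsilon> where "0 < \<epsilon>"
    "\<forall>Y\<in>L. N (\<lambda>\<omega>. Y \<omega> - X \<omega>) < \<epsilon> \<longrightarrow> Y \<notin> {X \<in> L. F X \<le> ereal b}"
    unfolding Lp_closed_def by blast
  then show ?thesis by (intro exI[of _ \<epsilon>]) (simp add: not_le)
qed

text \<open>A level \<open>b\<close> strictly between \<open>d\<close> and \<open>F X\<close> would
  eventually be exceeded by \<open>F (Xs n)\<close> but not by \<open>c n\<close>. The bounds may
  vary with \<open>n\<close> because the uses supply minimising sequences, bounds shifted by
  expectations, and bounds scaled by \<open>1 - t n\<close>.\<close>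

lemma closed_functional_limit:
  assumes F: "closed_functional M p F"
    and Xs: "\<And>n. Xs n \<in> L" and X: "X \<in> L"
    and lim: "(\<lambda>n. N (\<lambda>\<omega>. Xs n \<omega> - X \<omega>)) \<longlonglongrightarrow> 0"
    and le: "\<And>n. F (Xs n) \<le> ereal (c n)" and c: "c \<longlonglongrightarrow> d"
  shows "F X \<le> ereal d"
proof (rule ccontr)
  assume "\<not> F X \<le> ereal d"
  then obtain b where b: "d < b" "ereal b < F X"
    using ereal_dense2[of "ereal d" "F X"] by (auto simp: not_le)
  from closed_functional_open[OF F X b(2)] obtain \<epsilon> where \<epsilon>: "0 < \<epsilon>"
    "\<And>Y. Y \<in> L \<Longrightarrow> N (\<lambda>\<omega>. Y \<omega> - X \<omega>) < \<epsilon> \<Longrightarrow> ereal b < F Y" by blast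
  have "eventually (\<lambda>n. N (\<lambda>\<omega>. Xs n \<omega> - X \<omega>) < \<epsilon> \<and> c n < b) sequentially"
    using order_tendstoD(2)[OF lim \<epsilon>(1)] order_tendstoD(2)[OF c b(1)] by eventually_elim simp
  from eventually_happens'[OF sequentially_bot this]
  obtain n where n: "N (\<lambda>\<omega>. Xs n \<omega> - X \<omega>) < \<epsilon>" "c n < b" by blast
  have "ereal b < ereal (c n)" using \<epsilon>(2)[OF Xs n(1)] le[of n] by (rule less_le_trans)
  then show False using n(2) by simp
qed

text \<open>If no ball around \<open>X\<close> avoids the sublevel set, points chosen in the balls
  of radius \<open>1 / real (Suc n)\<close> form a sequence in it converging to \<open>X\<close>. So
  sequences suffice to test closedness.\<close>

lemma closed_functionalI:
  assumes "\<And>Xs X c. (\<And>n. Xs n \<in> L) \<Longrightarrow> X \<in> L \<Longrightarrow>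
    (\<lambda>n. N (\<lambda>\<omega>. Xs n \<omega> - X \<omega>)) \<longlonglongrightarrow> 0 \<Longrightarrow> (\<And>n. F (Xs n) \<le> ereal c) \<Longrightarrow> F X \<le> ereal c"
  shows "closed_functional M p F"
  unfolding closed_functional_def Lp_closed_def
proof (intro allI conjI ballI, blast, rule ccontr)
  fix C X
  assume X: "X \<in> L - {X \<in> L. F X \<le> ereal C}"
    and far: "\<not> (\<exists>\<epsilon>>0. \<forall>Y\<in>L. N (\<lambda>\<omega>. Y \<omega> - X \<omega>) < \<epsilon> \<longrightarrow> Y \<notin> {X \<in> L. F X \<le> ereal C})"
  have "\<forall>n. \<exists>Y. Y \<in> L \<and> N (\<lambda>\<omega>. Y \<omega> - X \<omega>) < 1 / real (Suc n) \<and> F Y \<le> ereal C"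
  proof
    fix n
    have "0 < 1 / real (Suc n)" by simp
    then show "\<exists>Y. Y \<in> L \<and> N (\<lambda>\<omega>. Y \<omega> - X \<omega>) < 1 / real (Suc n) \<and> F Y \<le> ereal C"
      using far by blast
  qed
  then obtain Xs where Xs: "\<And>n. Xs n \<in> L"
    "\<And>n. N (\<lambda>\<omega>. Xs n \<omega> - X \<omega>) < 1 / real (Suc n)" "\<And>n. F (Xs n) \<le> ereal C"
    by metis
  have "(\<lambda>n. N (\<lambda>\<omega>. Xs n \<omega> - X \<omega>)) \<longlonglongrightarrow> 0"
    using Xs(2) Lp_norm_nonneg[OF Lp_diff[OF Xs(1)]] X
    by (intro real_tendsto_sandwich[OF _ _ tendsto_const LIMSEQ_Suc[OF lim_1_over_n]])
       (auto intro!: always_eventually less_imp_le)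
  then show False using assms[OF Xs(1) _ _ Xs(3), of X] X by auto
qed

text \<open>The variable and the shift move simultaneously, as they do when minimisers of varying
  variables are followed. The factor \<open>t\<close> is for limits taken at a fixed place on a
  ray.\<close>

lemma tendsto_Lp_norm_scale_shift:
  assumes Xs: "\<And>n. Xs n \<in> L" and X: "X \<in> L"
    and lim: "(\<lambda>n. N (\<lambda>\<omega>. Xs n \<omega> - X \<omega>)) \<longlonglongrightarrow> 0" and C: "C \<longlonglongrightarrow> l"
  shows "(\<lambda>n. N (\<lambda>\<omega>. (t * (Xs n \<omega> - C n)) - (t * (X \<omega> - l)))) \<longlonglongrightarrow> 0"
proof (rule real_tendsto_sandwich[OF _ _ tendsto_const])
  let ?b = "\<lambda>n. \<bar>t\<bar> * (4 * (N (\<lambda>\<omega>. Xs n \<omega> - X \<omega>) + \<bar>l - C n\<bar>))"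
  have eq: "(\<lambda>\<omega>. (t * (Xs n \<omega> - C n)) - (t * (X \<omega> - l)))
      = (\<lambda>\<omega>. t * ((Xs n \<omega> - X \<omega>) + (l - C n)))" for n
    by (simp add: algebra_simps)
  have mem: "(\<lambda>\<omega>. (Xs n \<omega> - X \<omega>) + (l - C n)) \<in> L" for n
    by (intro Lp_shift(2) Lp_diff Xs X)
  have "N (\<lambda>\<omega>. t * ((Xs n \<omega> - X \<omega>) + (l - C n)))
      \<le> \<bar>t\<bar> * N (\<lambda>\<omega>. (Xs n \<omega> - X \<omega>) + (l - C n))" for n
    by (rule Lp_norm_scale[OF mem])
  also have "\<dots> n \<le> ?b n" for n
    using Lp_norm_add[OF Lp_diff[OF Xs X] Lp_const, of n "l - C n"] Lp_norm_const[of "l - C n"]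
    by (intro mult_left_mono) auto
  finally show "\<forall>\<^sub>F n in sequentially. N (\<lambda>\<omega>. (t * (Xs n \<omega> - C n)) - (t * (X \<omega> - l))) \<le> ?b n"
    unfolding eq by (intro always_eventually allI)
  have "?b \<longlonglongrightarrow> \<bar>t\<bar> * (4 * (0 + \<bar>l - l\<bar>))"
    by (intro tendsto_intros lim C)
  then show "?b \<longlonglongrightarrow> 0" by simp
  show "\<forall>\<^sub>F n in sequentially. 0 \<le> N (\<lambda>\<omega>. (t * (Xs n \<omega> - C n)) - (t * (X \<omega> - l)))"
    unfolding eq by (intro always_eventually allI Lp_norm_nonneg Lp_scale mem)
qed

lemma expectation_tendsto:
  assumes Xs: "\<And>n. Xs n \<in> L" and X: "X \<in> L"
    and lim: "(\<lambda>n. N (\<lambda>\<omega>. Xs n \<omega> - X \<omega>)) \<longlonglongrightarrow> 0"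
  shows "(\<lambda>n. expectation (Xs n)) \<longlonglongrightarrow> expectation X"
proof (rule LIM_zero_cancel, rule Lim_null_comparison)
  show "\<forall>\<^sub>F n in sequentially. norm (expectation (Xs n) - expectation X)
      \<le> 2 * N (\<lambda>\<omega>. Xs n \<omega> - X \<omega>)"
    using abs_expectation_le[OF Lp_diff[OF Xs X]] Lp_integrable[OF Xs] Lp_integrable[OF X]
    by (intro always_eventually allI) simp
  show "(\<lambda>n. 2 * N (\<lambda>\<omega>. Xs n \<omega> - X \<omega>)) \<longlonglongrightarrow> 0"
    using tendsto_mult_right_zero[OF lim, of 2] by simp
qed

section \<open>Adding a multiple of the expectation\<close>

context
  fixes F G :: "('a \<Rightarrow> real) \<Rightarrow> ereal" and a :: real
  assumes G: "\<And>X. X \<in> L \<Longrightarrow> G X = F X + ereal (a * expectation X)"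
begin

text \<open>A constant bound on \<open>G\<close> becomes the bound
  \<open>c - a * expectation (Xs n)\<close> on \<open>F\<close>, which varies with \<open>n\<close>
  but converges by continuity of the expectation.\<close>

lemma closed_functional_add_expectation:
  assumes F: "closed_functional M p F"
  shows "closed_functional M p G"
proof (rule closed_functionalI)
  fix Xs X c
  assume Xs: "\<And>n. Xs n \<in> L" and X: "X \<in> L"
    and lim: "(\<lambda>n. N (\<lambda>\<omega>. Xs n \<omega> - X \<omega>)) \<longlonglongrightarrow> 0" and le: "\<And>n. G (Xs n) \<le> ereal c"
  have "F (Xs n) \<le> ereal (c - a * expectation (Xs n))" for n
    using le[of n] by (cases "F (Xs n)") (auto simp: G[OF Xs])
  moreover have "(\<lambda>n. c - a * expectation (Xs n)) \<longlonglongrightarrow> c - a * expectation X"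
    by (intro tendsto_diff tendsto_mult_left tendsto_const expectation_tendsto[OF Xs X lim])
  ultimately have "F X \<le> ereal (c - a * expectation X)"
    by (rule closed_functional_limit[OF F Xs X lim])
  then show "G X \<le> ereal c" by (cases "F X") (auto simp: G[OF X])
qed

lemma convex_functional_add_expectation:
  assumes F: "convex_functional M p F"
  shows "convex_functional M p G"
  unfolding convex_functional_def
proof (intro ballI allI impI)
  fix X Y and t :: real
  assume X: "X \<in> L" and Y: "Y \<in> L" and t: "0 < t \<and> t < 1"
  let ?Z = "\<lambda>\<omega>. (1 - t) * X \<omega> + t * Y \<omega>"
  have Z: "?Z \<in> L" by (intro Lp_add Lp_scale X Y)
  have EZ: "expectation ?Z = (1 - t) * expectation X + t * expectation Y"
    using Lp_integrable[OF X] Lp_integrable[OF Y] by simp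
  have "F ?Z \<le> ereal (1 - t) * F X + ereal t * F Y"
    using t by (intro convex_functionalD[OF F X Y]) auto
  then have "F ?Z + ereal (a * ((1 - t) * expectation X + t * expectation Y))
      \<le> ereal (1 - t) * (F X + ereal (a * expectation X))
        + ereal t * (F Y + ereal (a * expectation Y))"
    using t by (cases "F X"; cases "F Y"; cases "F ?Z") (simp_all add: algebra_simps)
  then show "G ?Z \<le> ereal (1 - t) * G X + ereal t * G Y"
    unfolding G[OF Z] G[OF X] G[OF Y] EZ .
qed

lemma pos_homogeneous_add_expectation:
  assumes F: "pos_homogeneous M p F"
  shows "pos_homogeneous M p G"
  unfolding pos_homogeneous_def
proof (intro ballI allI impI)
  fix X and l :: real
  assume X: "X \<in> L" and l: "0 < l"
  have "F (\<lambda>\<omega>. l * X \<omega>) = ereal l * F X"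
    using F X l by (auto simp: pos_homogeneous_def)
  then show "G (\<lambda>\<omega>. l * X \<omega>) = ereal l * G X"
    using l by (cases "F X") (auto simp: G X Lp_scale algebra_simps)
qed

end

text \<open>
  For \<open>X \<le> Y\<close>, write \<open>X - tY\<close> as the combination of \<open>Y\<close> and \<open>(X - Y) / t\<close> with weights
  \<open>1 - t\<close> and \<open>t\<close>; the second term contributes nothing positive, and \<open>t \<rightarrow> 0\<close>.
\<close>

lemma monotone_functionalI:
  assumes F: "closed_functional M p F" "convex_functional M p F"
    and minus_infty: "\<And>X. X \<in> L \<Longrightarrow> F X \<noteq> -\<infinity>"
    and nonpos: "\<And>X. X \<in> L \<Longrightarrow> AE \<omega> in M. X \<omega> \<le> 0 \<Longrightarrow> F X \<le> 0"
  shows "monotone_functional M p F"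
  unfolding monotone_functional_def
proof (intro ballI impI)
  fix X Y assume X: "X \<in> L" and Y: "Y \<in> L" and le: "AE \<omega> in M. X \<omega> \<le> Y \<omega>"
  show "F X \<le> F Y"
  proof (cases "F Y")
    case (real y)
    \<comment> \<open>Two successors make \<open>t 0 = 1 / 2\<close>: convexity is stated only for
      weights strictly between 0 and 1.\<close>
    define t where "t n = inverse (real (Suc (Suc n)))" for n
    have t: "0 < t n" "t n < 1" for n by (auto simp: t_def field_simps)
    have t0: "t \<longlonglongrightarrow> 0"
      unfolding t_def by (rule LIMSEQ_Suc[OF LIMSEQ_inverse_real_of_nat])
    define Xs where "Xs n = (\<lambda>\<omega>. X \<omega> + (- t n) * Y \<omega>)" for n
    have mem: "Xs n \<in> L" for n unfolding Xs_def by (intro Lp_add Lp_scale X Y)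
    have bound: "F (Xs n) \<le> ereal ((1 - t n) * y)" for n
    proof -
      let ?D = "\<lambda>\<omega>. (1 / t n) * (X \<omega> - Y \<omega>)"
      have D: "?D \<in> L" by (intro Lp_scale Lp_diff X Y)
      have "AE \<omega> in M. ?D \<omega> \<le> 0"
        using le by eventually_elim (use t(1)[of n] in \<open>simp add: divide_le_0_iff\<close>)
      then have "F ?D \<le> 0" by (rule nonpos[OF D])
      then have nonpos': "ereal (t n) * F ?D \<le> 0"
        using t(1)[of n] by (simp add: ereal_mult_le_0_iff)
      have "Xs n = (\<lambda>\<omega>. (1 - t n) * Y \<omega> + t n * ?D \<omega>)"
        using t(1)[of n] by (simp add: Xs_def field_simps)
      then have "F (Xs n) \<le> ereal (1 - t n) * F Y + ereal (t n) * F ?D"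
        using convex_functionalD[OF F(2) Y D t[of n]] by (simp only:)
      also have "\<dots> \<le> ereal (1 - t n) * F Y + 0"
        by (rule add_left_mono[OF nonpos'])
      finally show ?thesis by (simp add: real)
    qed
    have lim: "(\<lambda>n. (1 - t n) * y) \<longlonglongrightarrow> (1 - 0) * y"
      by (intro tendsto_intros t0)
    have "(\<lambda>n. N (\<lambda>\<omega>. Xs n \<omega> - X \<omega>)) \<longlonglongrightarrow> 0"
    proof (rule Lim_null_comparison)
      have "norm (N (\<lambda>\<omega>. Xs n \<omega> - X \<omega>)) \<le> t n * N Y" for n
        using Lp_norm_scale[OF Y, of "- t n"] Lp_norm_nonneg[OF Lp_scale[OF Y, of "- t n"]]
          t(1)[of n] by (simp add: Xs_def)
      then show "\<forall>\<^sub>F n in sequentially. norm (N (\<lambda>\<omega>. Xs n \<omega> - X \<omega>)) \<le> t n * N Y"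
        by simp
      show "(\<lambda>n. t n * N Y) \<longlonglongrightarrow> 0" by (rule tendsto_mult_left_zero[OF t0])
    qed
    then have "F X \<le> ereal ((1 - 0) * y)"
      by (rule closed_functional_limit[OF F(1) mem X _ bound lim])
    then show ?thesis by (simp add: real)
  qed (use minus_infty[OF Y] in auto)
qed

section \<open>Errors and their coercivity along constants\<close>

lemma pos_homogeneousD:
  assumes "pos_homogeneous M p F" "X \<in> L" "0 < l"
  shows "F (\<lambda>\<omega>. l * X \<omega>) = ereal l * F X"
  using assms unfolding pos_homogeneous_def by blast

lemma error_boundedD:
  assumes "error_bounded M p E" "X \<in> L" "AE \<omega> in M. X \<omega> \<le> 0"
  shows "E X \<le> ereal \<bar>expectation X\<bar>"
  using assms unfolding error_bounded_def by blast

lemma error_measuresD: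
  assumes "E \<in> error_measures M p"
  shows "closed_functional M p E" "convex_functional M p E" "E (\<lambda>_. 0) = 0"
    "\<And>X. X \<in> L \<Longrightarrow> 0 \<le> E X"
    "\<And>X Y. X \<in> L \<Longrightarrow> Y \<in> L \<Longrightarrow> AE \<omega> in M. X \<omega> = Y \<omega> \<Longrightarrow> E X = E Y"
    "\<And>X. X \<in> L \<Longrightarrow> \<not> as_zero M X \<Longrightarrow> \<exists>l>0. 0 < E (\<lambda>\<omega>. l * X \<omega>)"
proof -
  note * = assms[unfolded error_measures_def Lp_functionals_def mem_Collect_eq]
  show "closed_functional M p E" "convex_functional M p E" "E (\<lambda>_. 0) = 0"
    "\<And>X Y. X \<in> L \<Longrightarrow> Y \<in> L \<Longrightarrow> AE \<omega> in M. X \<omega> = Y \<omega> \<Longrightarrow> E X = E Y"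
    "\<And>X. X \<in> L \<Longrightarrow> \<not> as_zero M X \<Longrightarrow> \<exists>l>0. 0 < E (\<lambda>\<omega>. l * X \<omega>)"
    using * by blast+
  have E: "E \<in> L \<rightarrow>\<^sub>E {0..}" using * by blast
  show "0 \<le> E X" if "X \<in> L" for X using PiE_mem[OF E that] by simp
qed

context
  fixes E :: "('a \<Rightarrow> real) \<Rightarrow> ereal"
  assumes E: "E \<in> error_measures M p"
begin

text \<open>Convexity between the zero variable, where \<open>E\<close> vanishes, and
  \<open>X\<close>. The weight 1 is not covered by convexity and is treated apart.\<close>

lemma error_scale_le:
  assumes X: "X \<in> L" and t: "0 < t" "t \<le> 1"
  shows "E (\<lambda>\<omega>. t * X \<omega>) \<le> ereal t * E X"
proof (cases "t = 1")
  case False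
  then have "t < 1" using t by simp
  from convex_functionalD[OF error_measuresD(2)[OF E] Lp_const[of 0] X t(1) this]
  show ?thesis by (simp add: error_measuresD(3)[OF E])
qed (simp add: one_ereal_def[symmetric])

lemma error_scale_le_real:
  assumes X: "X \<in> L" and t: "0 < t" "t \<le> 1" and le: "E X \<le> ereal c"
  shows "E (\<lambda>\<omega>. t * X \<omega>) \<le> ereal (t * c)"
proof -
  have "E (\<lambda>\<omega>. t * X \<omega>) \<le> ereal t * E X" by (rule error_scale_le[OF X t])
  also have "\<dots> \<le> ereal t * ereal c" using t le by (intro ereal_mult_left_mono) auto
  finally show ?thesis by simp
qed

text \<open>
  Scaling \<open>X + r s\<close> down to \<open>(l / r) X + l s\<close> with a fixed \<open>l\<close> such that \<open>E (l s) > 0\<close> makes its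
  error small and moves it close to \<open>l s\<close>, which for large \<open>r\<close> contradicts lower semicontinuity.
\<close>

lemma error_coercive_direction:
  assumes s: "s \<noteq> 0"
  shows "\<exists>B. \<forall>X\<in>L. \<forall>r>0. N X \<le> K \<longrightarrow> E (\<lambda>\<omega>. X \<omega> + r * s) \<le> ereal c \<longrightarrow> r \<le> B"
proof -
  have "\<not> as_zero M (\<lambda>_. s)" using s by (simp add: as_zero_def)
  then obtain l where l: "0 < l" "0 < E (\<lambda>_. l * s)"
    using error_measuresD(6)[OF E Lp_const] by blast
  obtain \<delta> where \<delta>: "0 < \<delta>" "ereal \<delta> < E (\<lambda>_. l * s)"
    using ereal_dense2[OF l(2)] by auto
  from closed_functional_open[OF error_measuresD(1)[OF E] Lp_const \<delta>(2)]
  obtain \<epsilon> where \<epsilon>: "0 < \<epsilon>"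
    "\<And>Y. Y \<in> L \<Longrightarrow> N (\<lambda>\<omega>. Y \<omega> - l * s) < \<epsilon> \<Longrightarrow> ereal \<delta> < E Y" by blast
  \<comment> \<open>Three demands on \<open>r > B\<close>: \<open>l / r\<close> must be an
    admissible scaling factor below 1, \<open>(l / r) * \<bar>c\<bar>\<close> at most
    \<open>\<delta>\<close>, and \<open>(l / r) * \<bar>K\<bar>\<close> below
    \<open>\<epsilon>\<close>.\<close>
  define B where "B = Max {l, l * \<bar>c\<bar> / \<delta>, l * \<bar>K\<bar> / \<epsilon>}"
  have "r \<le> B"
    if X: "X \<in> L" and r: "0 < r" and K: "N X \<le> K" and c: "E (\<lambda>\<omega>. X \<omega> + r * s) \<le> ereal c"
    for X r
  proof (rule ccontr)
    assume "\<not> r \<le> B"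
    then have rl: "l < r" and rc: "l * \<bar>c\<bar> / \<delta> < r" and rK: "l * \<bar>K\<bar> / \<epsilon> < r"
      unfolding B_def by auto
    let ?Y = "\<lambda>\<omega>. (l / r) * (X \<omega> + r * s)"
    have mem: "(\<lambda>\<omega>. X \<omega> + r * s) \<in> L" by (rule Lp_shift(2)[OF X])
    have Y: "?Y \<in> L" by (rule Lp_scale[OF mem])
    have "E ?Y \<le> ereal ((l / r) * c)"
      using l r rl by (intro error_scale_le_real[OF mem _ _ c]) auto
    also have "(l / r) * c \<le> (l / r) * \<bar>c\<bar>" using l r by (intro mult_left_mono) auto
    also have "(l / r) * \<bar>c\<bar> \<le> \<delta>" using rc r \<delta>(1) by (simp add: field_simps)
    finally have "E ?Y \<le> ereal \<delta>" by simp
    moreover have "N (\<lambda>\<omega>. ?Y \<omega> - l * s) < \<epsilon>"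
    proof -
      have "(\<lambda>\<omega>. ?Y \<omega> - l * s) = (\<lambda>\<omega>. (l / r) * X \<omega>)"
        using r by (simp add: distrib_left)
      then have "N (\<lambda>\<omega>. ?Y \<omega> - l * s) \<le> \<bar>l / r\<bar> * N X"
        using Lp_norm_scale[OF X, of "l / r"] by (simp only:)
      also have "\<dots> \<le> \<bar>l / r\<bar> * \<bar>K\<bar>" using K by (intro mult_left_mono) auto
      also have "\<dots> = l * \<bar>K\<bar> / r" using l r by simp
      also have "\<dots> < \<epsilon>" using rK r \<epsilon>(1) by (simp add: field_simps)
      finally show ?thesis .
    qed
    ultimately show False using \<epsilon>(2)[OF Y] by simp
  qed
  then show ?thesis by blast
qed

text \<open>Coercivity in the two directions 1 and -1 bounds the shifts on both sides, and
  Bolzano-Weierstrass does the rest. The bound is uniform in \<open>Xs\<close>, so the variables may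
  change along with the shifts.\<close>

lemma bounded_shifts_subsequence:
  fixes C :: "nat \<Rightarrow> real"
  assumes Xs: "\<And>n. Xs n \<in> L" "\<And>n. N (Xs n) \<le> K"
    and le: "\<And>n. E (\<lambda>\<omega>. Xs n \<omega> - C n) \<le> ereal c"
  obtains r l where "strict_mono r" "(C \<circ> r) \<longlonglongrightarrow> l"
proof -
  obtain B1 where B1: "\<And>X r. X \<in> L \<Longrightarrow> 0 < r \<Longrightarrow> N X \<le> K \<Longrightarrow>
      E (\<lambda>\<omega>. X \<omega> + r * 1) \<le> ereal c \<Longrightarrow> r \<le> B1"
    using error_coercive_direction[of 1 K c] by auto
  obtain B2 where B2: "\<And>X r. X \<in> L \<Longrightarrow> 0 < r \<Longrightarrow> N X \<le> K \<Longrightarrow>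
      E (\<lambda>\<omega>. X \<omega> + r * (- 1)) \<le> ereal c \<Longrightarrow> r \<le> B2"
    using error_coercive_direction[of "- 1" K c] by auto
  \<comment> \<open>A negative shift is the direction 1 with length \<open>- C n\<close>, a positive
    one the direction -1 with length \<open>C n\<close>; the 0 in the maximum covers
    \<open>C n = 0\<close>.\<close>
  have "\<bar>C n\<bar> \<le> max 0 (max B1 B2)" for n
    using B1[OF Xs(1)[of n], of "- C n"] B2[OF Xs(1)[of n], of "C n"] Xs(2)[of n] le[of n]
    by (cases "C n" "0 :: real" rule: linorder_cases) auto
  then have "bounded (range C)" by (auto simp: bounded_iff)
  from bounded_imp_convergent_subsequence[OF this] that show ?thesis by blast
qed

lemma error_shift_limit:
  assumes "\<And>n. Xs n \<in> L" "X \<in> L" "(\<lambda>n. N (\<lambda>\<omega>. Xs n \<omega> - X \<omega>)) \<longlonglongrightarrow> 0" "C \<longlonglongrightarrow> l"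
    and le: "\<And>n. E (\<lambda>\<omega>. t * (Xs n \<omega> - C n)) \<le> ereal (c n)" and c: "c \<longlonglongrightarrow> d"
  shows "E (\<lambda>\<omega>. t * (X \<omega> - l)) \<le> ereal d"
  by (rule closed_functional_limit[OF error_measuresD(1)[OF E] _ _
        tendsto_Lp_norm_scale_shift[OF assms(1-4)] le c])
     (intro Lp_scale Lp_shift(1) assms)+

section \<open>The deviation projected from an error\<close>

abbreviation Dev where "Dev \<equiv> deviation_of_error M p E"

lemma deviation_eq: "X \<in> L \<Longrightarrow> Dev X = (INF C. E (\<lambda>\<omega>. X \<omega> - C))"
  by (simp add: deviation_of_error_def error_objective_def)

lemma deviation_le: "X \<in> L \<Longrightarrow> Dev X \<le> E (\<lambda>\<omega>. X \<omega> - C)"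
  by (auto simp: deviation_eq intro: INF_lower)

lemma deviation_nonneg: "X \<in> L \<Longrightarrow> 0 \<le> Dev X"
  by (auto simp: deviation_eq intro!: INF_greatest error_measuresD(4)[OF E] Lp_shift)

text \<open>The direct method: the shifts of a minimising sequence stay bounded, a subsequence
  converges, and closedness of \<open>E\<close> makes its limit a minimiser. If the infimum is
  infinite, every constant attains it.\<close>

lemma deviation_attained:
  assumes X: "X \<in> L"
  shows "\<exists>C. Dev X = E (\<lambda>\<omega>. X \<omega> - C)"
proof (cases "Dev X")
  case (real m)
  have "\<forall>n. \<exists>C. E (\<lambda>\<omega>. X \<omega> - C) \<le> ereal (m + 1 / real (Suc n))"
  proof
    fix n
    have "(INF C. E (\<lambda>\<omega>. X \<omega> - C)) < ereal (m + 1 / real (Suc n))"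
      using real by (simp add: deviation_eq[OF X])
    then obtain C where "E (\<lambda>\<omega>. X \<omega> - C) < ereal (m + 1 / real (Suc n))"
      unfolding INF_less_iff by blast
    then show "\<exists>C. E (\<lambda>\<omega>. X \<omega> - C) \<le> ereal (m + 1 / real (Suc n))"
      by (intro exI[of _ C]) (rule less_imp_le)
  qed
  from choice[OF this] obtain C
    where C: "\<And>n. E (\<lambda>\<omega>. X \<omega> - C n) \<le> ereal (m + 1 / real (Suc n))" by blast
  have bound: "E (\<lambda>\<omega>. X \<omega> - C n) \<le> ereal (m + 1)" for n
    by (rule order_trans[OF C]) simp
  obtain r l where r: "strict_mono r" "(C \<circ> r) \<longlonglongrightarrow> l"
    by (rule bounded_shifts_subsequence[OF X order_refl bound])
  have "(\<lambda>n. m + 1 / real (Suc n)) \<longlonglongrightarrow> m + 0"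
    by (intro tendsto_add tendsto_const LIMSEQ_Suc[OF lim_1_over_n])
  from LIMSEQ_subseq_LIMSEQ[OF this r(1)]
  have c: "(\<lambda>n. m + 1 / real (Suc (r n))) \<longlonglongrightarrow> m + 0" by (simp add: o_def)
  have "(\<lambda>n. N (\<lambda>\<omega>. X \<omega> - X \<omega>)) \<longlonglongrightarrow> 0"
    using Lp_norm_const[of 0] Lp_norm_nonneg[OF Lp_const[of 0]] by simp
  then have "E (\<lambda>\<omega>. 1 * (X \<omega> - l)) \<le> ereal (m + 0)"
    by (rule error_shift_limit[OF X X _ r(2) _ c]) (simp add: C del: of_nat_Suc)
  then show ?thesis
    using deviation_le[OF X, of l] real by (intro exI[of _ l]) auto
next
  case PInf
  then show ?thesis using deviation_le[OF X, of 0] by (intro exI[of _ 0]) simp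
qed (use deviation_nonneg[OF X] in auto)

text \<open>Minimisers \<open>C n\<close> for the converging \<open>Xs n\<close> have a convergent
  subsequence, because the \<open>Xs n\<close> are bounded. Its limit \<open>l\<close> makes
  \<open>E (X - l)\<close> obey the same bound, and \<open>Dev X\<close> lies below that
  value.\<close>

lemma closed_deviation: "closed_functional M p Dev"
proof (rule closed_functionalI)
  fix Xs X c
  assume Xs: "\<And>n. Xs n \<in> L" and X: "X \<in> L"
    and lim: "(\<lambda>n. N (\<lambda>\<omega>. Xs n \<omega> - X \<omega>)) \<longlonglongrightarrow> 0" and le: "\<And>n. Dev (Xs n) \<le> ereal c"
  have "\<forall>n. \<exists>C. Dev (Xs n) = E (\<lambda>\<omega>. Xs n \<omega> - C)" using deviation_attained Xs by blast
  from choice[OF this] obtain C where "\<And>n. Dev (Xs n) = E (\<lambda>\<omega>. Xs n \<omega> - C n)" by blast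
  then have C: "E (\<lambda>\<omega>. Xs n \<omega> - C n) \<le> ereal c" for n using le[of n] by simp
  obtain K where K: "\<And>n. N (\<lambda>\<omega>. Xs n \<omega> - X \<omega>) \<le> K"
    using convergent_imp_Bseq[OF convergentI[OF lim]] unfolding Bseq_def
    by (auto dest: abs_le_D1)
  have bound: "N (Xs n) \<le> 4 * (K + N X)" for n
    using Lp_norm_add[OF Lp_diff[OF Xs[of n] X] X] K[of n] by simp
  obtain r l where r: "strict_mono r" "(C \<circ> r) \<longlonglongrightarrow> l"
    by (rule bounded_shifts_subsequence[OF Xs bound C])
  have "(\<lambda>n. N (\<lambda>\<omega>. Xs (r n) \<omega> - X \<omega>)) \<longlonglongrightarrow> 0"
    using LIMSEQ_subseq_LIMSEQ[OF lim r(1)] by (simp add: o_def)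
  then have "E (\<lambda>\<omega>. 1 * (X \<omega> - l)) \<le> ereal c"
    by (rule error_shift_limit[OF Xs X _ r(2) _ tendsto_const]) (simp add: C)
  then show "Dev X \<le> ereal c" using order_trans[OF deviation_le[OF X, of l]] by simp
qed

text \<open>The convex combination of minimisers for \<open>X\<close> and \<open>Y\<close> is a
  competitor for the combined variable; convexity of \<open>E\<close> bounds its value.\<close>

lemma convex_deviation: "convex_functional M p Dev"
  unfolding convex_functional_def
proof (intro ballI allI impI)
  fix X Y and t :: real
  assume X: "X \<in> L" and Y: "Y \<in> L" and t: "0 < t \<and> t < 1"
  obtain a where a: "Dev X = E (\<lambda>\<omega>. X \<omega> - a)" using deviation_attained[OF X] by blast
  obtain b where b: "Dev Y = E (\<lambda>\<omega>. Y \<omega> - b)" using deviation_attained[OF Y] by blast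
  have "Dev (\<lambda>\<omega>. (1 - t) * X \<omega> + t * Y \<omega>)
      \<le> E (\<lambda>\<omega>. ((1 - t) * X \<omega> + t * Y \<omega>) - ((1 - t) * a + t * b))"
    by (intro deviation_le Lp_add Lp_scale X Y)
  also have "(\<lambda>\<omega>. ((1 - t) * X \<omega> + t * Y \<omega>) - ((1 - t) * a + t * b))
      = (\<lambda>\<omega>. (1 - t) * (X \<omega> - a) + t * (Y \<omega> - b))"
    by (simp add: algebra_simps)
  also have "E \<dots> \<le> ereal (1 - t) * Dev X + ereal t * Dev Y"
    unfolding a b using t by (intro convex_functionalD error_measuresD(2)[OF E] Lp_shift X Y) auto
  finally show "Dev (\<lambda>\<omega>. (1 - t) * X \<omega> + t * Y \<omega>) \<le> ereal (1 - t) * Dev X + ereal t * Dev Y" .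
qed

text \<open>
  If \<open>Dev\<close> vanished on the whole ray through \<open>X\<close>, with minimisers \<open>C n\<close> at \<open>(n + 1) X\<close>, then
  the \<open>C n / (n + 1)\<close> would accumulate at some \<open>l\<close> with \<open>E\<close> vanishing on the ray through \<open>X - l\<close>.
\<close>

lemma deviation_nonconstant:
  assumes X: "X \<in> L" and nonconst: "\<not> as_constant M X"
  shows "\<exists>l>0. 0 < Dev (\<lambda>\<omega>. l * X \<omega>)"
proof (rule ccontr)
  assume zero_ray: "\<not> (\<exists>l>0. 0 < Dev (\<lambda>\<omega>. l * X \<omega>))"
  have "Dev (\<lambda>\<omega>. l * X \<omega>) \<le> 0" if "0 < l" for l :: real
    by (rule leI) (use zero_ray that in blast)
  then have zero: "Dev (\<lambda>\<omega>. real (Suc n) * X \<omega>) \<le> 0" for n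
    by (simp del: of_nat_Suc)
  have "\<forall>n. \<exists>C. E (\<lambda>\<omega>. real (Suc n) * X \<omega> - C) \<le> 0"
  proof
    fix n
    obtain C where "Dev (\<lambda>\<omega>. real (Suc n) * X \<omega>) = E (\<lambda>\<omega>. real (Suc n) * X \<omega> - C)"
      using deviation_attained[OF Lp_scale[OF X]] by blast
    then show "\<exists>C. E (\<lambda>\<omega>. real (Suc n) * X \<omega> - C) \<le> 0"
      using zero[of n] by (intro exI[of _ C]) (simp only:)
  qed
  from choice[OF this] obtain C
    where C: "\<And>n. E (\<lambda>\<omega>. real (Suc n) * X \<omega> - C n) \<le> 0" by blast
  define c where "c n = C n / real (Suc n)" for n
  \<comment> \<open>The zero of \<open>E\<close> at \<open>real (Suc n) * (X - c n)\<close> spreads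
    down the segment to the origin. The segments lengthen with \<open>n\<close>, so any fixed
    \<open>t\<close> is eventually covered.\<close>
  have small: "E (\<lambda>\<omega>. t * (X \<omega> - c n)) \<le> ereal 0" if t: "0 < t" "t \<le> real (Suc n)" for t n
  proof -
    have "(\<lambda>\<omega>. t * (X \<omega> - c n))
        = (\<lambda>\<omega>. (t / real (Suc n)) * (real (Suc n) * X \<omega> - C n))"
      by (simp add: c_def field_simps del: of_nat_Suc)
    moreover have "E (\<lambda>\<omega>. (t / real (Suc n)) * (real (Suc n) * X \<omega> - C n))
        \<le> ereal ((t / real (Suc n)) * 0)"
      using t by (intro error_scale_le_real[OF _ _ _ C[of n, unfolded zero_ereal_def]]
          Lp_shift Lp_scale X) auto
    ultimately show ?thesis by simp
  qed
  have bound: "E (\<lambda>\<omega>. X \<omega> - c n) \<le> ereal 0" for n using small[of 1 n] by simp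
  obtain r l where r: "strict_mono r" "(c \<circ> r) \<longlonglongrightarrow> l"
    by (rule bounded_shifts_subsequence[OF X order_refl bound])
  have ray: "E (\<lambda>\<omega>. t * (X \<omega> - l)) \<le> ereal 0" if t: "0 < t" for t
  proof -
    \<comment> \<open>Dropping the first \<open>k\<close> terms of the subsequence puts
      \<open>t\<close> within range of \<open>small\<close> for every remaining index, since
      \<open>r (n + k)\<close> is at least \<open>k\<close>.\<close>
    obtain k where k: "t \<le> real k" using real_arch_simple by blast
    have "E (\<lambda>\<omega>. t * (X \<omega> - c (r (n + k)))) \<le> ereal 0" for n
      using k seq_suble[OF r(1), of "n + k"] by (intro small t) linarith
    moreover have "(\<lambda>n. c (r (n + k))) \<longlonglongrightarrow> l"
      using LIMSEQ_ignore_initial_segment[OF r(2), of k] by (simp add: o_def)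
    moreover have "(\<lambda>n. N (\<lambda>\<omega>. X \<omega> - X \<omega>)) \<longlonglongrightarrow> 0"
      using Lp_norm_const[of 0] Lp_norm_nonneg[OF Lp_const[of 0]] by simp
    ultimately show ?thesis
      using error_shift_limit[where Xs = "\<lambda>_. X", OF X X _ _ _ tendsto_const] by blast
  qed
  have "\<not> as_zero M (\<lambda>\<omega>. X \<omega> - l)"
    using nonconst by (simp add: as_zero_def as_constant_def)
  then obtain t where "0 < t" "0 < E (\<lambda>\<omega>. t * (X \<omega> - l))"
    using error_measuresD(6)[OF E Lp_shift(1)[OF X]] by blast
  then show False using ray[of t] unfolding zero_ereal_def by (blast dest: leD)
qed

lemma deviation_cong:
  assumes X: "X \<in> L" and Y: "Y \<in> L" and eq: "AE \<omega> in M. X \<omega> = Y \<omega>"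
  shows "Dev X = Dev Y"
proof -
  have "E (\<lambda>\<omega>. X \<omega> - C) = E (\<lambda>\<omega>. Y \<omega> - C)" for C
    using eq by (intro error_measuresD(5)[OF E] Lp_shift X Y) auto
  then show ?thesis by (simp add: deviation_eq[OF X] deviation_eq[OF Y])
qed

lemma deviation_of_error_in: "Dev \<in> deviation_measures M p"
  unfolding deviation_measures_def Lp_functionals_def mem_Collect_eq
proof (intro conjI ballI allI impI)
  show "Dev \<in> L \<rightarrow>\<^sub>E {0..}"
    using deviation_nonneg by (intro PiE_I) (auto simp: deviation_of_error_def)
  show "Dev (\<lambda>_. C) = 0" for C
    using deviation_le[OF Lp_const, of C C] deviation_nonneg[OF Lp_const, of C]
      error_measuresD(3)[OF E] by simp
qed (fact closed_deviation convex_deviation deviation_cong deviation_nonconstant)+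

text \<open>Scaling a minimiser by \<open>l\<close> gives one inequality for every positive
  \<open>l\<close>; the same inequality with \<open>1 / l\<close>, applied to the scaled variable,
  gives the other.\<close>

lemma pos_homogeneous_deviation:
  assumes "pos_homogeneous M p E"
  shows "pos_homogeneous M p Dev"
proof -
  have le: "Dev (\<lambda>\<omega>. l * X \<omega>) \<le> ereal l * Dev X" if X: "X \<in> L" and l: "0 < l" for X and l :: real
  proof -
    obtain C where C: "Dev X = E (\<lambda>\<omega>. X \<omega> - C)" using deviation_attained[OF X] by blast
    have "Dev (\<lambda>\<omega>. l * X \<omega>) \<le> E (\<lambda>\<omega>. l * X \<omega> - l * C)"
      by (intro deviation_le Lp_scale X)
    also have "(\<lambda>\<omega>. l * X \<omega> - l * C) = (\<lambda>\<omega>. l * (X \<omega> - C))" by (simp add: algebra_simps)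
    also have "E \<dots> = ereal l * Dev X"
      unfolding C by (rule pos_homogeneousD[OF assms Lp_shift(1)[OF X] l])
    finally show ?thesis .
  qed
  show ?thesis unfolding pos_homogeneous_def
  proof (intro ballI allI impI antisym)
    fix X and l :: real
    assume X: "X \<in> L" and l: "0 < l"
    show "Dev (\<lambda>\<omega>. l * X \<omega>) \<le> ereal l * Dev X" by (rule le[OF X l])
    have "Dev (\<lambda>\<omega>. (1 / l) * (l * X \<omega>)) \<le> ereal (1 / l) * Dev (\<lambda>\<omega>. l * X \<omega>)"
      using l by (intro le[OF Lp_scale[OF X]]) simp
    then have "Dev X \<le> ereal (1 / l) * Dev (\<lambda>\<omega>. l * X \<omega>)" using l by simp
    then show "ereal l * Dev X \<le> Dev (\<lambda>\<omega>. l * X \<omega>)"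
      using l by (cases "Dev X"; cases "Dev (\<lambda>\<omega>. l * X \<omega>)") (auto simp: field_simps)
  qed
qed

text \<open>The competitor is \<open>C = s\<close>, a finite essential supremum of \<open>X\<close>.
  Then \<open>X - s\<close> is nonpositive, so the error bound applies and its right side is
  \<open>s - expectation X\<close>.\<close>

lemma deviation_bounded_deviation:
  assumes bounded: "error_bounded M p E"
  shows "deviation_bounded M p Dev"
  unfolding deviation_bounded_def
proof
  fix X assume X: "X \<in> L"
  let ?s = "esssup M (\<lambda>\<omega>. ereal (X \<omega>))"
  have ae: "AE \<omega> in M. ereal (X \<omega>) \<le> ?s" by (rule esssup_AE)
  show "Dev X \<le> ?s - ereal (expectation X)"
  proof (cases ?s)
    case (real s)
    have le: "AE \<omega> in M. X \<omega> - s \<le> 0" using ae by (simp add: real)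
    have "Dev X \<le> E (\<lambda>\<omega>. X \<omega> - s)" by (rule deviation_le[OF X])
    also have "\<dots> \<le> ereal \<bar>expectation (\<lambda>\<omega>. X \<omega> - s)\<bar>"
      by (rule error_boundedD[OF bounded Lp_shift(1)[OF X] le])
    also have "\<bar>expectation (\<lambda>\<omega>. X \<omega> - s)\<bar> = - expectation (\<lambda>\<omega>. X \<omega> - s)"
    proof (rule abs_of_nonpos)
      have "0 \<le> expectation (\<lambda>\<omega>. s - X \<omega>)"
        using le by (intro integral_nonneg_AE) (auto elim: eventually_mono)
      then show "expectation (\<lambda>\<omega>. X \<omega> - s) \<le> 0" using Lp_integrable[OF X] by simp
    qed
    also have "\<dots> = s - expectation X" using Lp_integrable[OF X] by (simp add: prob_space)
    finally show ?thesis by (simp add: real)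
  next
    case MInf
    then show ?thesis using ae by simp
  qed simp
qed

section \<open>The set of minimisers\<close>

text \<open>The set is compact by the subsequence argument at the level \<open>Dev X\<close> and
  convex by convexity of \<open>E\<close>, hence of the form \<open>{a..b}\<close>. That form allows
  the empty set; an attained minimum forces \<open>a \<le> b\<close>.\<close>

lemma argmin_error_interval:
  assumes X: "X \<in> L" and finite: "\<bar>error_objective E X C\<bar> \<noteq> \<infinity>"
  shows "\<exists>a b. a \<le> b \<and> argmin_set (error_objective E X) = {a..b}"
proof -
  let ?A = "argmin_set (error_objective E X)"
  have A_iff: "c \<in> ?A \<longleftrightarrow> E (\<lambda>\<omega>. X \<omega> - c) \<le> Dev X" for c
    by (auto simp: argmin_set_def is_arg_min_linorder error_objective_def deviation_eq[OF X]
        le_INF_iff)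
  \<comment> \<open>Finiteness of the objective at one constant provides the real level at which the
    shifts are bounded.\<close>
  obtain d where d: "Dev X = ereal d"
    using deviation_le[OF X, of C] deviation_nonneg[OF X] finite
    by (cases "Dev X") (auto simp: error_objective_def)
  obtain c where "Dev X = E (\<lambda>\<omega>. X \<omega> - c)" using deviation_attained[OF X] by blast
  then have "c \<in> ?A" by (simp add: A_iff)
  have const: "(\<lambda>n. N (\<lambda>\<omega>. X \<omega> - X \<omega>)) \<longlonglongrightarrow> 0"
    using Lp_norm_const[of 0] Lp_norm_nonneg[OF Lp_const[of 0]] by simp
  have "compact ?A"
    unfolding compact_def
  proof (intro allI impI)
    fix c :: "nat \<Rightarrow> real" assume "\<forall>n. c n \<in> ?A"
    then have bound: "E (\<lambda>\<omega>. X \<omega> - c n) \<le> ereal d" for n using A_iff d by simp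
    obtain r l where r: "strict_mono r" "(c \<circ> r) \<longlonglongrightarrow> l"
      by (rule bounded_shifts_subsequence[OF X order_refl bound])
    have "E (\<lambda>\<omega>. 1 * (X \<omega> - l)) \<le> ereal d"
      by (rule error_shift_limit[OF X X const r(2) _ tendsto_const]) (simp add: bound)
    then show "\<exists>l\<in>?A. \<exists>r. strict_mono r \<and> (c \<circ> r) \<longlonglongrightarrow> l" using r A_iff d by auto
  qed
  moreover have "convex ?A"
    unfolding convex_alt
  proof (intro ballI allI impI)
    fix a b t :: real assume ab: "a \<in> ?A" "b \<in> ?A" and t: "0 \<le> t \<and> t \<le> 1"
    show "(1 - t) *\<^sub>R a + t *\<^sub>R b \<in> ?A"
    proof (cases "t = 0 \<or> t = 1")
      case False
      then have t: "0 < t" "t < 1" using t by auto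
      have "(\<lambda>\<omega>. X \<omega> - ((1 - t) * a + t * b))
          = (\<lambda>\<omega>. (1 - t) * (X \<omega> - a) + t * (X \<omega> - b))"
        by (simp add: algebra_simps)
      then have "E (\<lambda>\<omega>. X \<omega> - ((1 - t) * a + t * b))
          \<le> ereal (1 - t) * E (\<lambda>\<omega>. X \<omega> - a) + ereal t * E (\<lambda>\<omega>. X \<omega> - b)"
        using convex_functionalD[OF error_measuresD(2)[OF E] Lp_shift(1)[OF X] Lp_shift(1)[OF X] t]
        by (simp only:)
      also have "\<dots> \<le> ereal (1 - t) * ereal d + ereal t * ereal d"
        using ab t A_iff d by (intro add_mono ereal_mult_left_mono) auto
      also have "\<dots> = ereal d" by (simp add: algebra_simps)
      finally show ?thesis by (simp add: A_iff d)
    qed (use ab in auto)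
  qed
  ultimately obtain a b where ab: "?A = {a..b}"
    using convex_connected connected_compact_interval_1 by blast
  with \<open>c \<in> ?A\<close> show ?thesis by auto
qed

end

section \<open>The correspondences given by subtracting and adding the expectation\<close>

lemma minus_expectation_eq:
  "X \<in> L \<Longrightarrow> minus_expectation M p F X = F X + ereal (- 1 * expectation X)"
  by (cases "F X") (simp_all add: minus_expectation_def)

lemma plus_expectation_eq:
  "X \<in> L \<Longrightarrow> plus_expectation M p F X = F X + ereal (1 * expectation X)"
  by (simp add: plus_expectation_def add.commute)

text \<open>On \<open>L\<close> the finite expectation cancels even where \<open>F\<close> is
  infinite; off \<open>L\<close> both sides are \<open>undefined\<close> by extensionality. This
  gives equality of functions, as the bijections require.\<close>

lemma plus_minus_expectation:
  assumes "F \<in> Lp_functionals M p T"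
  shows "plus_expectation M p (minus_expectation M p F) = F"
    and "minus_expectation M p (plus_expectation M p F) = F"
proof -
  have F: "F X = undefined" if "X \<notin> L" for X
    using assms that unfolding Lp_functionals_def mem_Collect_eq by (meson PiE_arb)
  have "plus_expectation M p (minus_expectation M p F) X = F X"
    "minus_expectation M p (plus_expectation M p F) X = F X" for X
    by (cases "X \<in> L"; cases "F X"; simp add: plus_expectation_def minus_expectation_def F)+
  then show "plus_expectation M p (minus_expectation M p F) = F"
    and "minus_expectation M p (plus_expectation M p F) = F" by blast+
qed

lemma Lp_functionals_add_expectation:
  assumes F: "F \<in> Lp_functionals M p T"
    and G: "\<And>X. X \<in> L \<Longrightarrow> G X = F X + ereal (a * expectation X)"
    and G': "\<And>X. X \<in> L \<Longrightarrow> G X \<in> T'" "\<And>X. X \<notin> L \<Longrightarrow> G X = undefined"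
  shows "G \<in> Lp_functionals M p T'"
  unfolding Lp_functionals_def mem_Collect_eq
proof (intro conjI ballI impI)
  fix X Y assume X: "X \<in> L" and Y: "Y \<in> L" and eq: "AE \<omega> in M. X \<omega> = Y \<omega>"
  have "F X = F Y" using F X Y eq unfolding Lp_functionals_def by blast
  moreover have "expectation X = expectation Y"
    using Lp_measurable[OF X] Lp_measurable[OF Y] eq by (rule integral_cong_AE)
  ultimately show "G X = G Y" by (simp add: G[OF X] G[OF Y])
qed (intro PiE_I G'; assumption)

lemma
  shows closed_functional_minus_expectation:
      "closed_functional M p F \<Longrightarrow> closed_functional M p (minus_expectation M p F)"
    and convex_functional_minus_expectation:
      "convex_functional M p F \<Longrightarrow> convex_functional M p (minus_expectation M p F)"
    and pos_homogeneous_minus_expectation: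
      "pos_homogeneous M p F \<Longrightarrow> pos_homogeneous M p (minus_expectation M p F)"
  by (rule closed_functional_add_expectation[where F = F and a = "- 1"]
      convex_functional_add_expectation[where F = F and a = "- 1"]
      pos_homogeneous_add_expectation[where F = F and a = "- 1"]; simp only: minus_expectation_eq)+

lemma
  shows closed_functional_plus_expectation:
      "closed_functional M p F \<Longrightarrow> closed_functional M p (plus_expectation M p F)"
    and convex_functional_plus_expectation:
      "convex_functional M p F \<Longrightarrow> convex_functional M p (plus_expectation M p F)"
    and pos_homogeneous_plus_expectation:
      "pos_homogeneous M p F \<Longrightarrow> pos_homogeneous M p (plus_expectation M p F)"
  by (rule closed_functional_add_expectation[where F = F and a = "1"]
      convex_functional_add_expectation[where F = F and a = "1"]
      pos_homogeneous_add_expectation[where F = F and a = "1"]; simp only: plus_expectation_eq)+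

lemma minus_expectation_in_Lp_functionals:
  assumes "F \<in> Lp_functionals M p T" "\<And>X. X \<in> L \<Longrightarrow> minus_expectation M p F X \<in> T'"
  shows "minus_expectation M p F \<in> Lp_functionals M p T'"
  by (rule Lp_functionals_add_expectation[where a = "- 1", OF assms(1)])
     (use assms(2) in \<open>simp_all only: minus_expectation_eq\<close>,
      simp_all add: minus_expectation_def)

lemma plus_expectation_in_Lp_functionals:
  assumes "F \<in> Lp_functionals M p T" "\<And>X. X \<in> L \<Longrightarrow> plus_expectation M p F X \<in> T'"
  shows "plus_expectation M p F \<in> Lp_functionals M p T'"
  by (rule Lp_functionals_add_expectation[where a = 1, OF assms(1)])
     (use assms(2) in \<open>simp_all only: plus_expectation_eq\<close>,
      simp_all add: plus_expectation_def)

lemma risk_measuresD: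
  assumes "R \<in> risk_measures M p"
  shows "R \<in> Lp_functionals M p {-\<infinity><..}" "closed_functional M p R" "convex_functional M p R"
    "R (\<lambda>_. C) = ereal C" "X \<in> L \<Longrightarrow> ereal (expectation X) \<le> R X"
    "X \<in> L \<Longrightarrow> \<not> as_constant M X \<Longrightarrow>
      \<exists>l>0. ereal (expectation (\<lambda>\<omega>. l * X \<omega>)) < R (\<lambda>\<omega>. l * X \<omega>)"
  using assms unfolding risk_measures_def mem_Collect_eq by blast+

lemma regret_measuresD:
  assumes "V \<in> regret_measures M p"
  shows "V \<in> Lp_functionals M p {-\<infinity><..}" "closed_functional M p V" "convex_functional M p V"
    "V (\<lambda>_. 0) = 0" "X \<in> L \<Longrightarrow> ereal (expectation X) \<le> V X"
    "X \<in> L \<Longrightarrow> \<not> as_zero M X \<Longrightarrow>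
      \<exists>l>0. ereal (expectation (\<lambda>\<omega>. l * X \<omega>)) < V (\<lambda>\<omega>. l * X \<omega>)"
  using assms unfolding regret_measures_def mem_Collect_eq by blast+

lemma deviation_measuresD:
  assumes "D \<in> deviation_measures M p"
  shows "D \<in> Lp_functionals M p {0..}" "closed_functional M p D" "convex_functional M p D"
    "D (\<lambda>_. C) = 0" "X \<in> L \<Longrightarrow> 0 \<le> D X"
    "X \<in> L \<Longrightarrow> \<not> as_constant M X \<Longrightarrow> \<exists>l>0. 0 < D (\<lambda>\<omega>. l * X \<omega>)"
proof -
  note * = assms[unfolded deviation_measures_def mem_Collect_eq]
  show D: "D \<in> Lp_functionals M p {0..}" using * by blast
  then have "D \<in> L \<rightarrow>\<^sub>E {0..}" unfolding Lp_functionals_def by blast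
  then show "0 \<le> D X" if "X \<in> L" using PiE_mem[OF _ that] by fastforce
qed (use assms in \<open>unfold deviation_measures_def mem_Collect_eq, blast\<close>)+

lemma minus_expectation_risk:
  assumes R: "R \<in> risk_measures M p"
  shows "minus_expectation M p R \<in> deviation_measures M p"
proof -
  note D = risk_measuresD[OF R]
  have "minus_expectation M p R \<in> Lp_functionals M p {0..}"
    by (rule minus_expectation_in_Lp_functionals[OF D(1)])
       (simp_all only: minus_expectation_eq atLeast_iff ereal_minus_real_nonneg_iff D(5))
  moreover have "closed_functional M p (minus_expectation M p R)"
    by (rule closed_functional_minus_expectation[OF D(2)])
  moreover have "convex_functional M p (minus_expectation M p R)"
    by (rule convex_functional_minus_expectation[OF D(3)])
  moreover have "minus_expectation M p R (\<lambda>_. C) = 0" for C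
    by (simp add: minus_expectation_eq[OF Lp_const] D(4) prob_space)
  moreover have "\<exists>l>0. 0 < minus_expectation M p R (\<lambda>\<omega>. l * X \<omega>)"
    if X: "X \<in> L" "\<not> as_constant M X" for X
    unfolding minus_expectation_eq[OF Lp_scale[OF X(1)]] ereal_minus_real_pos_iff
    by (rule D(6)[OF X])
  ultimately show ?thesis unfolding deviation_measures_def by blast
qed

lemma plus_expectation_deviation:
  assumes D: "D \<in> deviation_measures M p"
  shows "plus_expectation M p D \<in> risk_measures M p"
proof -
  note D = deviation_measuresD[OF D]
  have le: "ereal (expectation X) \<le> plus_expectation M p D X" if X: "X \<in> L" for X
    by (simp only: plus_expectation_eq[OF X] ereal_le_plus_real_iff D(5)[OF X])
  have "plus_expectation M p D X \<in> {-\<infinity><..}" if X: "X \<in> L" for X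
    using le[OF X] by (cases "plus_expectation M p D X") auto
  then have "plus_expectation M p D \<in> Lp_functionals M p {-\<infinity><..}"
    by (rule plus_expectation_in_Lp_functionals[OF D(1)])
  moreover have "closed_functional M p (plus_expectation M p D)"
    by (rule closed_functional_plus_expectation[OF D(2)])
  moreover have "convex_functional M p (plus_expectation M p D)"
    by (rule convex_functional_plus_expectation[OF D(3)])
  moreover have "plus_expectation M p D (\<lambda>_. C) = ereal C" for C
    by (simp add: plus_expectation_eq[OF Lp_const] D(4) prob_space)
  moreover have "\<exists>l>0. ereal (expectation (\<lambda>\<omega>. l * X \<omega>)) < plus_expectation M p D (\<lambda>\<omega>. l * X \<omega>)"
    if X: "X \<in> L" "\<not> as_constant M X" for X
    unfolding plus_expectation_eq[OF Lp_scale[OF X(1)]] ereal_less_plus_real_iff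
    by (rule D(6)[OF X])
  ultimately show ?thesis using le unfolding risk_measures_def by blast
qed

lemma minus_expectation_regret:
  assumes V: "V \<in> regret_measures M p"
  shows "minus_expectation M p V \<in> error_measures M p"
proof -
  note V = regret_measuresD[OF V]
  have "minus_expectation M p V \<in> Lp_functionals M p {0..}"
    by (rule minus_expectation_in_Lp_functionals[OF V(1)])
       (simp_all only: minus_expectation_eq atLeast_iff ereal_minus_real_nonneg_iff V(5))
  moreover have "closed_functional M p (minus_expectation M p V)"
    by (rule closed_functional_minus_expectation[OF V(2)])
  moreover have "convex_functional M p (minus_expectation M p V)"
    by (rule convex_functional_minus_expectation[OF V(3)])
  moreover have "minus_expectation M p V (\<lambda>_. 0) = 0"
    by (simp add: minus_expectation_eq[OF Lp_const] V(4))
  moreover have "\<exists>l>0. 0 < minus_expectation M p V (\<lambda>\<omega>. l * X \<omega>)"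
    if X: "X \<in> L" "\<not> as_zero M X" for X
    unfolding minus_expectation_eq[OF Lp_scale[OF X(1)]] ereal_minus_real_pos_iff
    by (rule V(6)[OF X])
  ultimately show ?thesis unfolding error_measures_def by blast
qed

lemma error_in_Lp_functionals: "E \<in> error_measures M p \<Longrightarrow> E \<in> Lp_functionals M p {0..}"
  unfolding error_measures_def by blast

lemma plus_expectation_error:
  assumes E: "E \<in> error_measures M p"
  shows "plus_expectation M p E \<in> regret_measures M p"
proof -
  note D = error_measuresD[OF E]
  have le: "ereal (expectation X) \<le> plus_expectation M p E X" if X: "X \<in> L" for X
    by (simp only: plus_expectation_eq[OF X] ereal_le_plus_real_iff D(4)[OF X])
  have "plus_expectation M p E X \<in> {-\<infinity><..}" if X: "X \<in> L" for X
    using le[OF X] by (cases "plus_expectation M p E X") auto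
  then have "plus_expectation M p E \<in> Lp_functionals M p {-\<infinity><..}"
    by (rule plus_expectation_in_Lp_functionals[OF error_in_Lp_functionals[OF E]])
  moreover have "closed_functional M p (plus_expectation M p E)"
    by (rule closed_functional_plus_expectation[OF D(1)])
  moreover have "convex_functional M p (plus_expectation M p E)"
    by (rule convex_functional_plus_expectation[OF D(2)])
  moreover have "plus_expectation M p E (\<lambda>_. 0) = 0"
    by (simp add: plus_expectation_eq[OF Lp_const] D(3))
  moreover have "\<exists>l>0. ereal (expectation (\<lambda>\<omega>. l * X \<omega>)) < plus_expectation M p E (\<lambda>\<omega>. l * X \<omega>)"
    if X: "X \<in> L" "\<not> as_zero M X" for X
    unfolding plus_expectation_eq[OF Lp_scale[OF X(1)]] ereal_less_plus_real_iff
    by (rule D(6)[OF X])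
  ultimately show ?thesis using le unfolding regret_measures_def by blast
qed

lemma pos_homogeneous_minus_expectation_iff:
  assumes "F \<in> Lp_functionals M p T"
  shows "pos_homogeneous M p F \<longleftrightarrow> pos_homogeneous M p (minus_expectation M p F)"
proof
  assume "pos_homogeneous M p F"
  then show "pos_homogeneous M p (minus_expectation M p F)"
    by (rule pos_homogeneous_minus_expectation)
next
  assume "pos_homogeneous M p (minus_expectation M p F)"
  then have "pos_homogeneous M p (plus_expectation M p (minus_expectation M p F))"
    by (rule pos_homogeneous_plus_expectation)
  then show "pos_homogeneous M p F" by (simp only: plus_minus_expectation(1)[OF assms])
qed

lemma Lp_functionals_not_MInf:
  assumes "F \<in> Lp_functionals M p {-\<infinity><..}" "X \<in> L"
  shows "F X \<noteq> -\<infinity>"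
proof -
  have "F \<in> L \<rightarrow>\<^sub>E {-\<infinity><..}" using assms(1) unfolding Lp_functionals_def by blast
  from PiE_mem[OF this assms(2)] show ?thesis by simp
qed

lemma monotone_functionalD:
  assumes "monotone_functional M p F" "X \<in> L" "Y \<in> L" "AE \<omega> in M. X \<omega> \<le> Y \<omega>"
  shows "F X \<le> F Y"
  using assms unfolding monotone_functional_def by blast

section \<open>Monotonicity as a bound on the deviation or the error\<close>

text \<open>After cancelling the expectation, the bound says that \<open>R X\<close> is at most the
  essential supremum of \<open>X\<close>. Monotonicity gives this by comparing \<open>X\<close> with
  that constant, on which \<open>R\<close> is the identity. Conversely it makes \<open>R\<close>
  nonpositive on nonpositive variables, which is the input of
  \<open>monotone_functionalI\<close>.\<close>

lemma monotone_risk_iff: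
  assumes R: "R \<in> risk_measures M p"
  shows "monotone_functional M p R \<longleftrightarrow> deviation_bounded M p (minus_expectation M p R)"
proof
  assume mono: "monotone_functional M p R"
  show "deviation_bounded M p (minus_expectation M p R)"
    unfolding deviation_bounded_def
  proof
    fix X assume X: "X \<in> L"
    let ?s = "esssup M (\<lambda>\<omega>. ereal (X \<omega>))"
    have ae: "AE \<omega> in M. ereal (X \<omega>) \<le> ?s" by (rule esssup_AE)
    show "minus_expectation M p R X \<le> ?s - ereal (expectation X)"
    proof (cases ?s)
      case (real s)
      have "AE \<omega> in M. X \<omega> \<le> s" using ae by (simp add: real)
      then have "R X \<le> R (\<lambda>_. s)" by (rule monotone_functionalD[OF mono X Lp_const])
      also have "\<dots> = ereal s" by (rule risk_measuresD(4)[OF R])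
      finally show ?thesis
        by (cases "R X") (simp_all add: real minus_expectation_eq[OF X])
    next
      case MInf
      then show ?thesis using ae by simp
    qed simp
  qed
next
  assume bounded: "deviation_bounded M p (minus_expectation M p R)"
  show "monotone_functional M p R"
  proof (rule monotone_functionalI[OF risk_measuresD(2,3)[OF R]])
    fix X assume X: "X \<in> L" and "AE \<omega> in M. X \<omega> \<le> 0"
    then have "esssup M (\<lambda>\<omega>. ereal (X \<omega>)) \<le> 0"
      using Lp_measurable[OF X] by (intro esssup_I) (auto simp: zero_ereal_def[symmetric])
    moreover have "minus_expectation M p R X
        \<le> esssup M (\<lambda>\<omega>. ereal (X \<omega>)) - ereal (expectation X)"
      using bounded X unfolding deviation_bounded_def by blast
    ultimately show "R X \<le> 0"
      by (cases "R X"; cases "esssup M (\<lambda>\<omega>. ereal (X \<omega>))")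
         (simp_all add: minus_expectation_eq[OF X])
  qed (rule Lp_functionals_not_MInf[OF risk_measuresD(1)[OF R]])
qed

text \<open>For \<open>X \<le> 0\<close> the absolute value of the expectation is its negative, so
  the error bound reads \<open>V X \<le> 0\<close>. Comparison with the zero variable yields this
  from monotonicity, and \<open>monotone_functionalI\<close> is the way back.\<close>

lemma monotone_regret_iff:
  assumes V: "V \<in> regret_measures M p"
  shows "monotone_functional M p V \<longleftrightarrow> error_bounded M p (minus_expectation M p V)"
proof -
  have iff: "minus_expectation M p V X \<le> ereal \<bar>expectation X\<bar> \<longleftrightarrow> V X \<le> 0"
    if X: "X \<in> L" and le: "AE \<omega> in M. X \<omega> \<le> 0" for X
  proof -
    have "0 \<le> expectation (\<lambda>\<omega>. - X \<omega>)"
      using le by (intro integral_nonneg_AE) (auto elim: eventually_mono)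
    then have "\<bar>expectation X\<bar> = - expectation X" by simp
    then show ?thesis by (cases "V X") (simp_all add: minus_expectation_eq[OF X])
  qed
  show ?thesis
  proof
    assume mono: "monotone_functional M p V"
    have "V X \<le> 0" if "X \<in> L" "AE \<omega> in M. X \<omega> \<le> 0" for X
      using monotone_functionalD[OF mono that(1) Lp_const that(2)] regret_measuresD(4)[OF V]
      by simp
    then show "error_bounded M p (minus_expectation M p V)"
      unfolding error_bounded_def using iff by blast
  next
    assume bounded: "error_bounded M p (minus_expectation M p V)"
    show "monotone_functional M p V"
    proof (rule monotone_functionalI[OF regret_measuresD(2,3)[OF V]])
      show "V X \<le> 0" if "X \<in> L" "AE \<omega> in M. X \<omega> \<le> 0" for X
        using error_boundedD[OF bounded that] iff[OF that] by blast
    qed (rule Lp_functionals_not_MInf[OF regret_measuresD(1)[OF V]])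
  qed
qed

section \<open>The regret objective as a shifted error objective\<close>

text \<open>The expectation of \<open>X - C\<close> contributes \<open>- C\<close>, which cancels
  the leading \<open>C\<close>. What remains beside the error does not depend on \<open>C\<close>,
  so both problems have the same minimisers and their minima differ by
  \<open>expectation X\<close>.\<close>

lemma regret_objective_eq:
  assumes X: "X \<in> L"
  shows "regret_objective V X C
    = error_objective (minus_expectation M p V) X C + ereal (expectation X)"
proof -
  have "expectation (\<lambda>\<omega>. X \<omega> - C) = expectation X - C"
    using Lp_integrable[OF X] by (simp add: prob_space)
  then show ?thesis
    by (cases "V (\<lambda>\<omega>. X \<omega> - C)")
       (simp_all add: regret_objective_def error_objective_def minus_expectation_eq[OF Lp_shift(1)[OF X]])
qed

lemma argmin_regret_eq:
  assumes X: "X \<in> L"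
  shows "argmin_set (regret_objective V X)
    = argmin_set (error_objective (minus_expectation M p V) X)"
  by (simp add: argmin_set_def is_arg_min_linorder regret_objective_eq[OF X] ereal_add_real_le_iff)

text \<open>Translation by \<open>C\<close> permutes the reals, so both functions compete against
  the same values. It is applied to the objectives of \<open>X + C\<close> and \<open>X\<close>, as
  \<open>X + C - c\<close> equals \<open>X - (c - C)\<close>.\<close>

lemma argmin_set_translate:
  fixes f g :: "real \<Rightarrow> ereal"
  assumes f: "\<And>c. f c = g (c - C)"
  shows "argmin_set f = (\<lambda>c. c + C) ` argmin_set g"
proof -
  have iff: "c \<in> argmin_set f \<longleftrightarrow> c - C \<in> argmin_set g" for c
  proof -
    have "(\<forall>d. g (c - C) \<le> g (d - C)) \<longleftrightarrow> (\<forall>d. g (c - C) \<le> g d)"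
    proof (intro iffI allI)
      fix d assume "\<forall>d. g (c - C) \<le> g (d - C)"
      from spec[OF this, of "d + C"] show "g (c - C) \<le> g d" by simp
    qed (erule spec)
    then show ?thesis by (simp add: argmin_set_def is_arg_min_linorder f)
  qed
  show ?thesis
  proof (intro set_eqI iffI)
    fix c assume "c \<in> argmin_set f"
    then show "c \<in> (\<lambda>c. c + C) ` argmin_set g"
      by (intro image_eqI[of _ _ "c - C"]) (simp_all add: iff)
  next
    fix c assume "c \<in> (\<lambda>c. c + C) ` argmin_set g"
    then show "c \<in> argmin_set f" by (auto simp: iff)
  qed
qed

lemma argmin_error_translate:
  "argmin_set (error_objective E (\<lambda>\<omega>. X \<omega> + C)) = (\<lambda>c. c + C) ` argmin_set (error_objective E X)"
proof (rule argmin_set_translate)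
  fix c
  have "(\<lambda>\<omega>. X \<omega> + C - c) = (\<lambda>\<omega>. X \<omega> - (c - C))" by (simp add: algebra_simps)
  then show "error_objective E (\<lambda>\<omega>. X \<omega> + C) c = error_objective E X (c - C)"
    by (simp only: error_objective_def)
qed

section \<open>Risk and the full quadrangle obtained from a regret\<close>

context
  fixes V :: "('a \<Rightarrow> real) \<Rightarrow> ereal"
  assumes V: "V \<in> regret_measures M p"
begin

lemmas error_of_regret = minus_expectation_regret[OF V]

text \<open>A minimiser of the error objective also minimises the regret objective, so both infima
  are evaluated at the same constant. All properties of the risk are then inherited from the
  projected deviation.\<close>

lemma risk_of_regret_eq:
  "risk_of_regret M p V = plus_expectation M p (deviation_of_error M p (minus_expectation M p V))"
proof
  fix X
  show "risk_of_regret M p V X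
    = plus_expectation M p (deviation_of_error M p (minus_expectation M p V)) X"
  proof (cases "X \<in> L")
    case X: True
    obtain C where C: "deviation_of_error M p (minus_expectation M p V) X
        = minus_expectation M p V (\<lambda>\<omega>. X \<omega> - C)"
      using deviation_attained[OF error_of_regret X] by blast
    have "(INF C. regret_objective V X C) = regret_objective V X C"
    proof (intro antisym INF_lower INF_greatest UNIV_I)
      fix c
      show "regret_objective V X C \<le> regret_objective V X c"
        unfolding regret_objective_eq[OF X] ereal_add_real_le_iff error_objective_def
          C[symmetric]
        by (rule deviation_le[OF error_of_regret X])
    qed
    also have "\<dots> = plus_expectation M p (deviation_of_error M p (minus_expectation M p V)) X"
      unfolding regret_objective_eq[OF X] error_objective_def plus_expectation_eq[OF X] C by simp
    finally show ?thesis by (simp add: risk_of_regret_def X)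
  qed (simp add: risk_of_regret_def plus_expectation_def)
qed

lemma risk_of_regret_in: "risk_of_regret M p V \<in> risk_measures M p"
  unfolding risk_of_regret_eq
  by (rule plus_expectation_deviation[OF deviation_of_error_in[OF error_of_regret]])

lemma minus_expectation_risk_of_regret:
  "minus_expectation M p (risk_of_regret M p V)
    = deviation_of_error M p (minus_expectation M p V)"
  unfolding risk_of_regret_eq
  by (rule plus_minus_expectation(2)
      [OF deviation_measuresD(1)[OF deviation_of_error_in[OF error_of_regret]]])

lemma pos_homogeneous_risk_of_regret:
  assumes "pos_homogeneous M p V"
  shows "pos_homogeneous M p (risk_of_regret M p V)"
proof -
  have "pos_homogeneous M p (minus_expectation M p V)"
    using assms pos_homogeneous_minus_expectation_iff[OF regret_measuresD(1)[OF V]] by blast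
  then have "pos_homogeneous M p (minus_expectation M p (risk_of_regret M p V))"
    unfolding minus_expectation_risk_of_regret
    by (rule pos_homogeneous_deviation[OF error_of_regret])
  then show ?thesis
    using pos_homogeneous_minus_expectation_iff[OF risk_measuresD(1)[OF risk_of_regret_in]] by blast
qed

text \<open>Monotonicity travels through the bounds: a monotone regret bounds the error, hence the
  projected deviation, and that bound makes the risk monotone.\<close>

lemma monotone_risk_of_regret:
  assumes "monotone_functional M p V"
  shows "monotone_functional M p (risk_of_regret M p V)"
proof -
  have "error_bounded M p (minus_expectation M p V)"
    using assms monotone_regret_iff[OF V] by blast
  then have "deviation_bounded M p (minus_expectation M p (risk_of_regret M p V))"
    unfolding minus_expectation_risk_of_regret
    by (rule deviation_bounded_deviation[OF error_of_regret])
  then show ?thesis using monotone_risk_iff[OF risk_of_regret_in] by blast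
qed

lemma argmin_regret_interval:
  assumes X: "X \<in> L" and finite: "\<bar>regret_objective V X C\<bar> \<noteq> \<infinity>"
  shows "\<exists>a b. a \<le> b \<and> argmin_set (regret_objective V X) = {a..b}"
proof -
  have "\<bar>error_objective (minus_expectation M p V) X C\<bar> \<noteq> \<infinity>"
    using finite unfolding regret_objective_eq[OF X]
    by (cases "error_objective (minus_expectation M p V) X C") simp_all
  then show ?thesis
    unfolding argmin_regret_eq[OF X] by (rule argmin_error_interval[OF error_of_regret X])
qed

text \<open>One minimiser \<open>C\<close> of the error objective witnesses both minimum conditions.
  Where the objectives are identically infinite the minimum value is \<open>\<infinity>\<close>,
  attained at every constant.\<close>

lemma risk_quadrangle_of_regret:
  "risk_quadrangle M p (risk_of_regret M p V)
    (deviation_of_error M p (minus_expectation M p V)) V (minus_expectation M p V)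
    (\<lambda>X. argmin_set (regret_objective V X))"
  unfolding risk_quadrangle_def
proof (intro conjI ballI)
  let ?E = "minus_expectation M p V"
  fix X assume X: "X \<in> L"
  obtain C where C: "deviation_of_error M p ?E X = error_objective ?E X C"
    using deviation_attained[OF error_of_regret X] unfolding error_objective_def by blast
  have le: "deviation_of_error M p ?E X \<le> error_objective ?E X c" for c
    unfolding error_objective_def by (rule deviation_le[OF error_of_regret X])
  show "is_min_value (deviation_of_error M p ?E X) (error_objective ?E X)"
    using C le unfolding is_min_value_def by blast
  show R: "risk_of_regret M p V X = deviation_of_error M p ?E X + ereal (expectation X)"
    by (simp add: risk_of_regret_eq plus_expectation_eq[OF X])
  have "risk_of_regret M p V X = regret_objective V X C"
    unfolding R regret_objective_eq[OF X] C ..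
  moreover have "risk_of_regret M p V X \<le> regret_objective V X c" for c
    unfolding R regret_objective_eq[OF X] ereal_add_real_le_iff by (rule le)
  ultimately show "is_min_value (risk_of_regret M p V X) (regret_objective V X)"
    unfolding is_min_value_def by blast
  show "V X = ?E X + ereal (expectation X)"
    by (cases "V X") (simp_all add: minus_expectation_eq[OF X])
  show "argmin_set (regret_objective V X) = argmin_set (error_objective ?E X)"
    by (rule argmin_regret_eq[OF X])
qed (rule risk_of_regret_in deviation_of_error_in[OF error_of_regret] V error_of_regret refl)+

lemma argmin_regret_translate:
  assumes X: "X \<in> L"
  shows "argmin_set (regret_objective V (\<lambda>\<omega>. X \<omega> + C))
    = (\<lambda>c. c + C) ` argmin_set (regret_objective V X)"
  unfolding argmin_regret_eq[OF X] argmin_regret_eq[OF Lp_shift(2)[OF X]]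
  by (rule argmin_error_translate)

end

lemma risk_deviation_correspondence:
  "bij_betw (minus_expectation M p) (risk_measures M p) (deviation_measures M p)"
  "bij_betw (plus_expectation M p) (deviation_measures M p) (risk_measures M p)"
  "R \<in> risk_measures M p \<Longrightarrow> D \<in> deviation_measures M p \<Longrightarrow>
    D = minus_expectation M p R \<longleftrightarrow> R = plus_expectation M p D"
proof -
  have pm: "plus_expectation M p (minus_expectation M p R) = R" if "R \<in> risk_measures M p" for R
    by (rule plus_minus_expectation(1)[OF risk_measuresD(1)[OF that]])
  have mp: "minus_expectation M p (plus_expectation M p D) = D" if "D \<in> deviation_measures M p" for D
    by (rule plus_minus_expectation(2)[OF deviation_measuresD(1)[OF that]])
  show "bij_betw (minus_expectation M p) (risk_measures M p) (deviation_measures M p)"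
    by (rule bij_betwI[where g = "plus_expectation M p"])
       (auto simp: pm mp intro: minus_expectation_risk plus_expectation_deviation)
  show "bij_betw (plus_expectation M p) (deviation_measures M p) (risk_measures M p)"
    by (rule bij_betwI[where g = "minus_expectation M p"])
       (auto simp: pm mp intro: minus_expectation_risk plus_expectation_deviation)
  show "D = minus_expectation M p R \<longleftrightarrow> R = plus_expectation M p D"
    if "R \<in> risk_measures M p" "D \<in> deviation_measures M p"
    using pm[OF that(1)] mp[OF that(2)] by auto
qed

lemma regret_error_correspondence:
  "bij_betw (minus_expectation M p) (regret_measures M p) (error_measures M p)"
  "bij_betw (plus_expectation M p) (error_measures M p) (regret_measures M p)"
  "V \<in> regret_measures M p \<Longrightarrow> E \<in> error_measures M p \<Longrightarrow>
    E = minus_expectation M p V \<longleftrightarrow> V = plus_expectation M p E"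
proof -
  have pm: "plus_expectation M p (minus_expectation M p V) = V" if "V \<in> regret_measures M p" for V
    by (rule plus_minus_expectation(1)[OF regret_measuresD(1)[OF that]])
  have mp: "minus_expectation M p (plus_expectation M p E) = E" if "E \<in> error_measures M p" for E
    by (rule plus_minus_expectation(2)[OF error_in_Lp_functionals[OF that]])
  show "bij_betw (minus_expectation M p) (regret_measures M p) (error_measures M p)"
    by (rule bij_betwI[where g = "plus_expectation M p"])
       (auto simp: pm mp intro: minus_expectation_regret plus_expectation_error)
  show "bij_betw (plus_expectation M p) (error_measures M p) (regret_measures M p)"
    by (rule bij_betwI[where g = "minus_expectation M p"])
       (auto simp: pm mp intro: minus_expectation_regret plus_expectation_error)
  show "E = minus_expectation M p V \<longleftrightarrow> V = plus_expectation M p E"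
    if "V \<in> regret_measures M p" "E \<in> error_measures M p"
    using pm[OF that(1)] mp[OF that(2)] by auto
qed

end

theorem theorem13:
  fixes M :: "'a measure" and p :: ennreal
    and R\<^sub>0 D\<^sub>0 V\<^sub>0 E\<^sub>0 :: "('a \<Rightarrow> real) \<Rightarrow> ereal" and S\<^sub>0 :: "('a \<Rightarrow> real) \<Rightarrow> real set"
  assumes "prob_space M" and "1 \<le> p"
    and "risk_quadrangle M p R\<^sub>0 D\<^sub>0 V\<^sub>0 E\<^sub>0 S\<^sub>0"
  shows
    "(\<comment> \<open>(a)\<close>
      bij_betw (minus_expectation M p) (risk_measures M p) (deviation_measures M p) \<and>
      bij_betw (plus_expectation M p) (deviation_measures M p) (risk_measures M p) \<and>
      (\<forall>R \<in> risk_measures M p. \<forall>D \<in> deviation_measures M p.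
         (D = minus_expectation M p R \<longleftrightarrow> R = plus_expectation M p D) \<and>
         (D = minus_expectation M p R \<longrightarrow>
            (pos_homogeneous M p R \<longleftrightarrow> pos_homogeneous M p D) \<and>
            (monotone_functional M p R \<longleftrightarrow> deviation_bounded M p D))))
     \<and>
     (\<comment> \<open>(b)\<close>
      bij_betw (minus_expectation M p) (regret_measures M p) (error_measures M p) \<and>
      bij_betw (plus_expectation M p) (error_measures M p) (regret_measures M p) \<and>
      (\<forall>V \<in> regret_measures M p. \<forall>E \<in> error_measures M p.
         (E = minus_expectation M p V \<longleftrightarrow> V = plus_expectation M p E) \<and>
         (E = minus_expectation M p V \<longrightarrow>
            (pos_homogeneous M p V \<longleftrightarrow> pos_homogeneous M p E) \<and>
            (monotone_functional M p V \<longleftrightarrow> error_bounded M p E))))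
     \<and>
     (\<comment> \<open>(c)\<close>
      \<forall>V \<in> regret_measures M p.
         risk_of_regret M p V \<in> risk_measures M p \<and>
         (pos_homogeneous M p V \<longrightarrow> pos_homogeneous M p (risk_of_regret M p V)) \<and>
         (monotone_functional M p V \<longrightarrow> monotone_functional M p (risk_of_regret M p V)))
     \<and>
     (\<comment> \<open>(d)\<close>
      \<forall>E \<in> error_measures M p.
         deviation_of_error M p E \<in> deviation_measures M p \<and>
         (pos_homogeneous M p E \<longrightarrow> pos_homogeneous M p (deviation_of_error M p E)) \<and>
         (error_bounded M p E \<longrightarrow> deviation_bounded M p (deviation_of_error M p E)))
     \<and>
     (\<comment> \<open>(e), intervals of minimisers\<close>
      (\<forall>V \<in> regret_measures M p. \<forall>X \<in> Lp_space M p.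
         (\<exists>C. \<bar>regret_objective V X C\<bar> \<noteq> \<infinity>) \<longrightarrow>
         (\<exists>a b. a \<le> b \<and> argmin_set (regret_objective V X) = {a..b})) \<and>
      (\<forall>E \<in> error_measures M p. \<forall>X \<in> Lp_space M p.
         (\<exists>C. \<bar>error_objective E X C\<bar> \<noteq> \<infinity>) \<longrightarrow>
         (\<exists>a b. a \<le> b \<and> argmin_set (error_objective E X) = {a..b})))
     \<and>
     (\<comment> \<open>(e), paired \<open>V\<close> and \<open>E\<close> give the associated statistic\<close>
      \<forall>V \<in> regret_measures M p. \<forall>E \<in> error_measures M p.
         E = minus_expectation M p V \<longrightarrow>
         (\<forall>X \<in> Lp_space M p.
            argmin_set (regret_objective V X) = argmin_set (error_objective E X)) \<and>
         risk_quadrangle M p (risk_of_regret M p V) (deviation_of_error M p E) V E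
           (\<lambda>X. argmin_set (regret_objective V X)) \<and>
         (\<forall>X \<in> Lp_space M p. \<forall>C.
            argmin_set (regret_objective V (\<lambda>\<omega>. X \<omega> + C))
              = (\<lambda>c. c + C) ` argmin_set (regret_objective V X)))
     \<and>
     (\<comment> \<open>(e), the statistic of the given quadrangle\<close>
      \<forall>X \<in> Lp_space M p.
         S\<^sub>0 X = argmin_set (regret_objective V\<^sub>0 X) \<and>
         S\<^sub>0 X = argmin_set (error_objective E\<^sub>0 X) \<and>
         (\<forall>C. S\<^sub>0 (\<lambda>\<omega>. X \<omega> + C) = (\<lambda>c. c + C) ` S\<^sub>0 X))"
proof -
  interpret Lp_prob_space M p
    using assms(1,2) by (simp add: Lp_prob_space_def Lp_prob_space_axioms_def)
  have S: "S\<^sub>0 X = argmin_set (error_objective E\<^sub>0 X)"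
    "S\<^sub>0 X = argmin_set (regret_objective V\<^sub>0 X)" if "X \<in> Lp_space M p" for X
    using assms(3) that unfolding risk_quadrangle_def by blast+
  show ?thesis
  proof (intro conjI ballI allI impI)
    fix R D assume R: "R \<in> risk_measures M p" and D: "D \<in> deviation_measures M p"
    show "D = minus_expectation M p R \<longleftrightarrow> R = plus_expectation M p D"
      by (rule risk_deviation_correspondence(3)[OF R D])
    assume eq: "D = minus_expectation M p R"
    show "pos_homogeneous M p R \<longleftrightarrow> pos_homogeneous M p D"
      unfolding eq by (rule pos_homogeneous_minus_expectation_iff[OF risk_measuresD(1)[OF R]])
    show "monotone_functional M p R \<longleftrightarrow> deviation_bounded M p D"
      unfolding eq by (rule monotone_risk_iff[OF R])
  next
    fix V E assume V: "V \<in> regret_measures M p" and E: "E \<in> error_measures M p"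
    show "E = minus_expectation M p V \<longleftrightarrow> V = plus_expectation M p E"
      by (rule regret_error_correspondence(3)[OF V E])
    assume eq: "E = minus_expectation M p V"
    show "pos_homogeneous M p V \<longleftrightarrow> pos_homogeneous M p E"
      unfolding eq by (rule pos_homogeneous_minus_expectation_iff[OF regret_measuresD(1)[OF V]])
    show "monotone_functional M p V \<longleftrightarrow> error_bounded M p E"
      unfolding eq by (rule monotone_regret_iff[OF V])
    show "risk_quadrangle M p (risk_of_regret M p V) (deviation_of_error M p E) V E
        (\<lambda>X. argmin_set (regret_objective V X))"
      unfolding eq by (rule risk_quadrangle_of_regret[OF V])
    fix X assume X: "X \<in> Lp_space M p"
    show "argmin_set (regret_objective V X) = argmin_set (error_objective E X)"
      unfolding eq by (rule argmin_regret_eq[OF X])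
    show "argmin_set (regret_objective V (\<lambda>\<omega>. X \<omega> + C))
        = (\<lambda>c. c + C) ` argmin_set (regret_objective V X)" for C
      by (rule argmin_regret_translate[OF V X])
  next
    fix V X assume V: "V \<in> regret_measures M p" and X: "X \<in> Lp_space M p"
      and finite: "\<exists>C. \<bar>regret_objective V X C\<bar> \<noteq> \<infinity>"
    from finite obtain C where "\<bar>regret_objective V X C\<bar> \<noteq> \<infinity>" by (rule exE)
    then show "\<exists>a b. a \<le> b \<and> argmin_set (regret_objective V X) = {a..b}"
      by (rule argmin_regret_interval[OF V X])
  next
    fix E X assume E: "E \<in> error_measures M p" and X: "X \<in> Lp_space M p"
      and finite: "\<exists>C. \<bar>error_objective E X C\<bar> \<noteq> \<infinity>"
    from finite obtain C where "\<bar>error_objective E X C\<bar> \<noteq> \<infinity>" by (rule exE)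
    then show "\<exists>a b. a \<le> b \<and> argmin_set (error_objective E X) = {a..b}"
      by (rule argmin_error_interval[OF E X])
  next
    fix X assume X: "X \<in> Lp_space M p"
    show "S\<^sub>0 X = argmin_set (error_objective E\<^sub>0 X)"
      "S\<^sub>0 X = argmin_set (regret_objective V\<^sub>0 X)" by (rule S[OF X])+
    show "S\<^sub>0 (\<lambda>\<omega>. X \<omega> + C) = (\<lambda>c. c + C) ` S\<^sub>0 X" for C
      unfolding S(1)[OF X] S(1)[OF Lp_shift(2)[OF X]] by (rule argmin_error_translate)
  qed (fact risk_deviation_correspondence regret_error_correspondence risk_of_regret_in
      pos_homogeneous_risk_of_regret monotone_risk_of_regret deviation_of_error_in
      pos_homogeneous_deviation deviation_bounded_deviation)+
qed

end
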